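(* Let $f \in \mathcal{F}_{st}$ and $\omega \in \mathcal{W}_{>0}$, and let $K \subset DOA(f)$ be compact. Then there exists a compact set $J$ with $K \subset J \subset DOA(f)$ such that the Lyapunov solution operator $\mathcal{G}(g,\psi) := V_{g,\psi}$, regarded as a map from $\mathcal{F}_{st}\times\mathcal{W}_{>0}$ to $C^1(J)$, is continuous at $(f,\omega)$ when $\mathcal{F}_{st}\times\mathcal{W}_{>0}$ is endowed with the norm $\|g\|_{C^1(J)}+\|\psi\|_{C^2(J)}$ and $C^1(J)$ is endowed with the uniform norm $\|\cdot\|_{\infty,J}$. That is, for every $\varepsilon>0$ there exists $\rho>0$ such that for all $(g,\psi)\in\mathcal{F}_{st}\times\mathcal{W}_{>0}$ with $\|g-f\|_{C^1(J)}+\|\psi-\omega\|_{C^2(J)}<\rho$, the function $V_{g,\psi}$ is well defined on $J$ and belongs to $C^1(J)$, and $\sup_{x\in J}|V_{g,\psi}(x)-V_{f,\omega}(x)|<\varepsilon$.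
   Context: Fix $n\ge 1$. $\mathcal{F}_0$ is the set of $f\in C^1(\mathbb{R}^n;\mathbb{R}^n)$ with $f(0)=0$. $\mathcal{F}_{st}$ is the set of $f\in\mathcal{F}_0$ whose Jacobian $\frac{\partial f}{\partial x}(0)$ is Hurwitz (all eigenvalues have negative real part). $\mathcal{W}_{>0}$ is the set of $\omega\in C^2(\mathbb{R}^n;\mathbb{R})$ with $\omega(0)=0$, $\nabla\omega(0)=0$ and Hessian $\nabla^2\omega(x)$ positive definite for every $x\in\mathbb{R}^n$. For $f\in\mathcal{F}_0$, $\phi_f(t,x)$ denotes the flow, i.e. the solution at time $t$ of $\dot x=f(x)$ with initial value $x$ at $t=0$. The domain of attraction is $DOA(f):=\{x\in\mathbb{R}^n : \phi_f(t,x) \text{ exists for all } t\ge 0 \text{ and } \lim_{t\to\infty}\phi_f(t,x)=0\}$. For $g \in \mathcal{F}_{st}$, $\psi\in\mathcal{W}_{>0}$, define $V_{g,\psi}(x):=\int_0^\infty \psi(\phi_g(t,x))\,dt$ for those $x$ (in particular $x\in DOA(g)$) for which $\phi_g(t,x)$ exists for all $t\ge0$ and the integral is finite. For a compact set $J\subset\mathbb{R}^n$, $\|h\|_{\infty,J}=\sup_{x\in J}\|h(x)\|$. For $k\in\{1,2\}$ and a function $h$ that is $C^k$ on a neighborhood of $J$, $\|h\|_{C^k(J)}$ is the sum of the suprema over $J$ of the norms of the derivatives of $h$ of orders $0,\dots,k$. $C^1(J)$ denotes the functions on $J$ that are restrictions of $C^1$ functions defined on an open neighborhood of $J$. *)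

theory Defs
  imports "HOL-Analysis.Analysis"
begin

section \<open>Functions of class C1 and C2, and their norms\<close>

text \<open>The Frechet derivative as an element of the normed space of bounded linear maps, so that its
  continuity and its own derivative can be stated. The norm on this space is the operator norm.\<close>

definition Df :: "('a::real_normed_vector \<Rightarrow> 'b::real_normed_vector) \<Rightarrow> 'a \<Rightarrow> 'a \<Rightarrow>\<^sub>L 'b"
  where "Df f x = Blinfun (frechet_derivative f (at x))"

lemma blinfun_apply_Df:
  assumes "(f has_derivative f') (at x)"
  shows "blinfun_apply (Df f x) = f'"
  using frechet_derivative_at[OF assms] has_derivative_bounded_linear[OF assms]
  by (simp add: Df_def bounded_linear_Blinfun_apply)

text \<open>The following two predicates are meant for open \<open>U\<close>.\<close>

definition C1_on :: "'a::real_normed_vector set \<Rightarrow> ('a \<Rightarrow> 'b::real_normed_vector) \<Rightarrow> bool"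
  where "C1_on U f \<longleftrightarrow> (\<forall>x\<in>U. f differentiable (at x)) \<and> continuous_on U (Df f)"

definition C2_on :: "'a::real_normed_vector set \<Rightarrow> ('a \<Rightarrow> 'b::real_normed_vector) \<Rightarrow> bool"
  where "C2_on U f \<longleftrightarrow> C1_on U f \<and> C1_on U (Df f)"

definition C1_restrictions :: "'a::real_normed_vector set \<Rightarrow> ('a \<Rightarrow> 'b::real_normed_vector) set"
  where "C1_restrictions J = {h. \<exists>U H. open U \<and> J \<subseteq> U \<and> C1_on U H \<and> (\<forall>x\<in>J. h x = H x)}"

text \<open>The supremum is taken in the reals, so it is meaningful only for nonempty \<open>J\<close> and for \<open>h\<close>
  bounded on \<open>J\<close>; the latter holds when \<open>J\<close> is compact and \<open>h\<close> is continuous on \<open>J\<close>.\<close>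

definition sup_norm :: "'a set \<Rightarrow> ('a \<Rightarrow> 'b::real_normed_vector) \<Rightarrow> real"
  where "sup_norm J h = (SUP x\<in>J. norm (h x))"

definition C1_norm :: "'a::real_normed_vector set \<Rightarrow> ('a \<Rightarrow> 'b::real_normed_vector) \<Rightarrow> real"
  where "C1_norm J h = sup_norm J h + sup_norm J (Df h)"

definition C2_norm :: "'a::real_normed_vector set \<Rightarrow> ('a \<Rightarrow> 'b::real_normed_vector) \<Rightarrow> real"
  where "C2_norm J h = sup_norm J h + sup_norm J (Df h) + sup_norm J (Df (Df h))"

section \<open>Vector fields and cost functions\<close>

definition complex_eigenvalue :: "real^'n^'n \<Rightarrow> complex \<Rightarrow> bool"
  where "complex_eigenvalue A \<mu> \<longleftrightarrow>
    (\<exists>v::complex^'n. v \<noteq> 0 \<and> (\<chi> i j. complex_of_real (A $ i $ j)) *v v = \<mu> *s v)"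

definition Hurwitz :: "real^'n^'n \<Rightarrow> bool"
  where "Hurwitz A \<longleftrightarrow> (\<forall>\<mu>. complex_eigenvalue A \<mu> \<longrightarrow> Re \<mu> < 0)"

definition F0 :: "(real^'n \<Rightarrow> real^'n) set"
  where "F0 = {f. C1_on UNIV f \<and> f 0 = 0}"

definition Fst :: "(real^'n \<Rightarrow> real^'n) set"
  where "Fst = {f \<in> F0. Hurwitz (jacobian f (at 0))}"

definition Hessian :: "(real^'n \<Rightarrow> real) \<Rightarrow> real^'n \<Rightarrow> real^'n^'n"
  where "Hessian \<omega> x =
    (\<chi> i j. blinfun_apply (blinfun_apply (Df (Df \<omega>) x) (axis i 1)) (axis j 1))"

text \<open>Symmetry is not demanded here: it is automatic for the Hessian of a C2 function.\<close>

definition positive_definite :: "real^'n^'n \<Rightarrow> bool"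
  where "positive_definite A \<longleftrightarrow> (\<forall>v. v \<noteq> 0 \<longrightarrow> v \<bullet> (A *v v) > 0)"

definition Wpos :: "(real^'n \<Rightarrow> real) set"
  where "Wpos = {\<omega>. C2_on UNIV \<omega> \<and> \<omega> 0 = 0 \<and> (GDERIV \<omega> 0 :> 0) \<and>
    (\<forall>x. positive_definite (Hessian \<omega> x))}"

section \<open>Flow, domain of attraction and Lyapunov integral\<close>

text \<open>\<open>y\<close> solves the initial value problem on the closed interval between 0 and \<open>t\<close>
  (where \<open>t\<close> may be negative); derivatives at the end points are one-sided.\<close>

definition solves_ivp ::
    "('a::real_normed_vector \<Rightarrow> 'a) \<Rightarrow> 'a \<Rightarrow> real \<Rightarrow> (real \<Rightarrow> 'a) \<Rightarrow> bool"
  where "solves_ivp f x t y \<longleftrightarrow> y 0 = x \<and>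
    (\<forall>s\<in>closed_segment 0 t. (y has_vector_derivative f (y s)) (at s within closed_segment 0 t))"

definition flow_exists :: "('a::real_normed_vector \<Rightarrow> 'a) \<Rightarrow> real \<Rightarrow> 'a \<Rightarrow> bool"
  where "flow_exists f t x \<longleftrightarrow> (\<exists>y. solves_ivp f x t y)"

text \<open>For C1 vector fields solutions are unique, so the description below is proper
  whenever \<open>flow_exists f t x\<close> holds.\<close>

definition flow :: "('a::real_normed_vector \<Rightarrow> 'a) \<Rightarrow> real \<Rightarrow> 'a \<Rightarrow> 'a"
  where "flow f t x = (THE z. \<exists>y. solves_ivp f x t y \<and> y t = z)"

definition DOA :: "('a::real_normed_vector \<Rightarrow> 'a) \<Rightarrow> 'a set"
  where "DOA f = {x. (\<forall>t\<ge>0. flow_exists f t x) \<and> ((\<lambda>t. flow f t x) \<longlongrightarrow> 0) at_top}"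

definition V_defined ::
    "('a::real_normed_vector \<Rightarrow> 'a) \<Rightarrow> ('a \<Rightarrow> real) \<Rightarrow> 'a \<Rightarrow> bool"
  where "V_defined g \<psi> x \<longleftrightarrow>
    (\<forall>t\<ge>0. flow_exists g t x) \<and> (\<lambda>t. \<psi> (flow g t x)) integrable_on {0..}"

definition V :: "('a::real_normed_vector \<Rightarrow> 'a) \<Rightarrow> ('a \<Rightarrow> real) \<Rightarrow> 'a \<Rightarrow> real"
  where "V g \<psi> x = integral {0..} (\<lambda>t. \<psi> (flow g t x))"

end

theory Submission
  imports Defs "HOL-Computational_Algebra.Fundamental_Theorem_Algebra" "HOL-Real_Asymp.Real_Asymp"
begin

text \<open>The set \<open>J\<close> has to be invariant not only under the flow of \<open>f\<close> but under the flow of every \<open>g\<close> that is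
close to \<open>f\<close> on \<open>J\<close> itself, since outside \<open>J\<close> nothing is known about \<open>g\<close>. Sublevel sets of \<open>V f \<omega>\<close> do not
serve this purpose, because they need not be compact: trajectories may escape to infinity in finite
backward time. Instead \<open>J\<close> is built from tubes around single trajectories.

Near the equilibrium, a Hurwitz Jacobian \<open>A\<close> admits a symmetric bilinear form \<open>b\<close> with
\<open>b x (A x) \<le> - a * b x x\<close>, and by continuity of the derivative the same estimate, with a smaller rate,
holds for the derivative of every \<open>g\<close> that is C1-close to \<open>f\<close> on a small ellipsoid
\<open>B = {x. b x x \<le> r\<^sup>2}\<close>. Hence \<open>B\<close> is invariant under \<open>g\<close>, and trajectories in \<open>B\<close> decay exponentially. For a
point \<open>p\<close> in the domain of attraction, the trajectory of \<open>p\<close> reaches the interior of \<open>B\<close> at some time \<open>T\<close>;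
around it lies a tube whose radius grows in time faster than trajectories of \<open>f\<close> diverge. Gronwall's
inequality shows that a trajectory of \<open>g\<close> which starts in the tube stays in it until it arrives in \<open>B\<close>
(\<open>robust_tube\<close>). At time 0 the tube contains a ball around \<open>p\<close>, so finitely many tubes cover \<open>K\<close>, and
\<open>J\<close> is the union of these tubes and \<open>B\<close> (\<open>robust_basin\<close>). All \<open>g\<close>-trajectories from \<open>J\<close> decay with one common
exponential rate, and \<open>\<psi>\<close> grows at most linearly on \<open>J\<close>. The tails of the two Lyapunov integrals are
therefore uniformly small, and on a bounded time interval Gronwall's inequality makes the integrands close.

That \<open>V g \<psi>\<close> is C1 on the open set \<open>DOA g\<close> (\<open>Lyapunov_integral_C1\<close>) follows by differentiating under
the integral sign. In \<open>B\<close> the flow contracts differences of trajectories, solutions of the variational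
equation and the remainder terms alike, so that one estimate (\<open>exponential_estimate\<close>) supplies an
integrable bound for all of them.

The form \<open>b\<close> is found algebraically (\<open>form_decreasing_up_to_shifts\<close>). Over the complex numbers
\<open>(A - m\<^sub>1) \<cdots> (A - m\<^sub>k) = 0\<close> for suitable eigenvalues, and \<open>b\<close> is a sum of suitably weighted terms
\<open>|(A - m\<^sub>1) \<cdots> (A - m\<^sub>j) x|\<^sup>2\<close> with \<open>j < k\<close>. Solutions of the differential equations come from a single application of
the Banach fixed point theorem to globally Lipschitz vector fields; a C1 field is made globally
Lipschitz by composing it with the projection to a large ball.\<close>

section \<open>Differential inequalities and trapping\<close>

lemma gronwall_affine:
  fixes S S' :: "real \<Rightarrow> real"
  assumes "a \<le> b" and cont: "continuous_on {a..b} S"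
    and deriv: "\<And>t. a < t \<Longrightarrow> t < b \<Longrightarrow> (S has_real_derivative S' t) (at t)"
    and le: "\<And>t. a < t \<Longrightarrow> t < b \<Longrightarrow> S' t \<le> c * (S t - m)"
  shows "S b - m \<le> exp (c * (b - a)) * (S a - m)"
proof -
  define F where "F t = exp (- c * t) * (S t - m)" for t
  have "F b \<le> F a"
  proof (rule DERIV_nonpos_imp_decreasing_open[OF \<open>a \<le> b\<close>])
    show "continuous_on {a..b} F"
      unfolding F_def by (intro continuous_intros cont)
  next
    fix t assume t: "a < t" "t < b"
    have "(F has_real_derivative exp (- c * t) * (S' t - c * (S t - m))) (at t)"
      unfolding F_def
      by (rule derivative_eq_intros deriv[OF t] refl | simp)+ (simp add: algebra_simps)
    moreover have "exp (- c * t) * (S' t - c * (S t - m)) \<le> 0"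
      using le[OF t] by (simp add: mult_le_0_iff)
    ultimately show "\<exists>y. (F has_real_derivative y) (at t) \<and> y \<le> 0"
      by blast
  qed
  then have "exp (c * b) * F b \<le> exp (c * b) * F a"
    by simp
  moreover have "exp (c * b) * F b = S b - m"
    by (simp add: F_def exp_minus)
  moreover have "exp (c * b) * F a = exp (c * (b - a)) * (S a - m)"
    by (simp add: F_def right_diff_distrib exp_diff exp_minus divide_simps)
  ultimately show ?thesis by simp
qed

text \<open>Typically \<open>N\<close> is an open neighbourhood of \<open>J\<close> on which a differential inequality is known, and
the inequality forces the curve into the smaller set \<open>J\<close>. At the first time outside \<open>N\<close> the curve
would, by \<open>step\<close>, lie in \<open>J\<close> and hence in \<open>N\<close>. The case \<open>s = a\<close> of \<open>step\<close> says that the curve starts in \<open>J\<close>.\<close>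

lemma trapped_curve:
  fixes y :: "real \<Rightarrow> 'a::topological_space"
  assumes cont: "continuous_on {a..b} y" and "open N" and "J \<subseteq> N"
    and step: "\<And>s. a \<le> s \<Longrightarrow> s \<le> b \<Longrightarrow> (\<And>t. a \<le> t \<Longrightarrow> t < s \<Longrightarrow> y t \<in> N) \<Longrightarrow> y s \<in> J"
    and t: "t \<in> {a..b}"
  shows "y t \<in> J"
proof -
  define E where "E = {a..b} \<inter> y -` (- N)"
  have "E = {}"
  proof (rule ccontr)
    assume "E \<noteq> {}"
    have "closed E"
      unfolding E_def using cont \<open>open N\<close>
      by (intro continuous_closed_preimage) auto
    have bdd: "bdd_below E"
      unfolding E_def by (auto intro: bdd_belowI[of _ a])
    have "Inf E \<in> E"
      using \<open>E \<noteq> {}\<close> \<open>closed E\<close> bdd closed_contains_Inf by blast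
    moreover have "y s \<in> N" if "a \<le> s" "s < Inf E" for s
    proof (rule ccontr)
      assume "y s \<notin> N"
      then have "s \<in> E"
        using that \<open>Inf E \<in> E\<close> by (auto simp: E_def)
      then show False
        using cInf_lower[OF _ bdd] that by fastforce
    qed
    ultimately show False
      using step[of "Inf E"] \<open>J \<subseteq> N\<close> by (auto simp: E_def)
  qed
  then show ?thesis
    using step[of t] t by (force simp: E_def)
qed

section \<open>Existence and uniqueness of solutions\<close>

lemma has_vector_derivative_at_right_half_line:
  assumes "(y has_vector_derivative d) (at t within {0..t+1})" "0 \<le> t"
  shows "(y has_vector_derivative d) (at t within {0..})"
proof -
  have "at t within {0..} = at t within {0..t+1}"
    by (rule at_within_nhd[of _ "{..<t+1}"]) auto
  then show ?thesis using assms by simp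
qed

lemma integral_exp_interval:
  fixes l :: real
  assumes "l > 0" "0 \<le> t"
  shows "((\<lambda>s. c * exp (l * s)) has_integral c * (exp (l * t) - 1) / l) {0..t}"
proof -
  have "((\<lambda>s. c * exp (l * s)) has_integral c * exp (l * t) / l - c * exp (l * 0) / l) {0..t}"
    by (rule fundamental_theorem_of_calculus)
       (use assms in \<open>auto intro!: derivative_eq_intros simp: has_real_derivative_iff_has_vector_derivative[symmetric]\<close>)
  then show ?thesis
    by (simp add: algebra_simps diff_divide_distrib)
qed

text \<open>A curve \<open>y\<close> on the half line is sought in the form \<open>y t = exp (l * t) * z t\<close> with \<open>z\<close> bounded and
\<open>l > \<bar>L\<bar>\<close>. In terms of \<open>z\<close> the integral operator of Picard is a contraction with constant \<open>\<bar>L\<bar> / l\<close>, so that the whole solution is obtained at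
once, without gluing local ones. The right-hand side may depend on time and take values in a Banach
space because the variational equation, an equation for operators, is an instance.\<close>

lemma global_solution_Lipschitz:
  fixes F :: "real \<Rightarrow> 'a::banach \<Rightarrow> 'a"
  assumes cont: "\<And>z. continuous_on {0..} z \<Longrightarrow> continuous_on {0..} (\<lambda>t. F t (z t))"
    and lip: "\<And>t x y. 0 \<le> t \<Longrightarrow> norm (F t x - F t y) \<le> L * norm (x - y)"
    and bdd: "\<And>t. 0 \<le> t \<Longrightarrow> norm (F t 0) \<le> N"
  obtains y where "y 0 = x0"
    and "\<And>t. 0 \<le> t \<Longrightarrow> (y has_vector_derivative F t (y t)) (at t within {0..})"
proof -
  define l where "l = \<bar>L\<bar> + 1"
  have l: "l > 0" "\<bar>L\<bar> < l" by (auto simp: l_def)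
  have lip': "norm (F t x - F t y) \<le> \<bar>L\<bar> * norm (x - y)" if "0 \<le> t" for t x y
    using lip[OF that, of x y] mult_right_mono[OF abs_ge_self, of "norm (x - y)" L] by simp
  have "N \<ge> 0" using bdd[of 0] norm_ge_zero order_trans by blast
  \<comment> \<open>\<open>P\<close> is Picard's operator acting on \<open>z\<close>; it is extended by a constant to negative times so that it
    acts on bounded continuous functions on the whole real line.\<close>
  define G where "G z t = F t (exp (l * t) *\<^sub>R apply_bcontfun z t)" for z :: "real \<Rightarrow>\<^sub>C 'a" and t
  define P where "P z t = exp (- l * max 0 t) *\<^sub>R (x0 + integral {0..max 0 t} (G z))" for z t
  have contG: "continuous_on {0..} (G z)" for z
    unfolding G_def by (intro cont continuous_intros) auto
  have contG': "continuous_on {0..t} (G z)" for z t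
    using contG by (rule continuous_on_subset) auto
  have intG: "G z integrable_on {0..t}" for z t
    using contG' by (rule integrable_continuous_interval)
  have int_exp: "(\<lambda>r. C * exp (l * r)) integrable_on {0..t}" for C t
    by (intro integrable_continuous_interval continuous_intros)
  have G_diff: "norm (G z t - G w t) \<le> (\<bar>L\<bar> * dist z w) * exp (l * t)" if "0 \<le> t" for z w t
  proof -
    have "norm (G z t - G w t) \<le> \<bar>L\<bar> * (exp (l * t) * dist (apply_bcontfun z t) (apply_bcontfun w t))"
      using lip'[OF that] unfolding G_def
      by (metis (no_types) abs_exp_cancel dist_norm norm_scaleR scaleR_right_diff_distrib)
    also have "\<dots> \<le> \<bar>L\<bar> * (exp (l * t) * dist z w)"
      by (intro mult_left_mono dist_bounded) auto
    finally show ?thesis by (simp add: algebra_simps)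
  qed
  have G_bound: "norm (G z t) \<le> (N + \<bar>L\<bar> * norm z) * exp (l * t)" if "0 \<le> t" for z t
  proof -
    have "norm (G z t - F t 0) \<le> \<bar>L\<bar> * (exp (l * t) * norm (apply_bcontfun z t))"
      using lip'[OF that, of "exp (l * t) *\<^sub>R apply_bcontfun z t" 0] unfolding G_def by simp
    also have "\<dots> \<le> \<bar>L\<bar> * (exp (l * t) * norm z)"
      by (intro mult_left_mono norm_bounded) auto
    finally have 1: "norm (G z t - F t 0) \<le> \<bar>L\<bar> * norm z * exp (l * t)" by (simp add: algebra_simps)
    have "norm (F t 0) \<le> N * 1" using bdd[OF that] by simp
    also have "N * 1 \<le> N * exp (l * t)"
      using \<open>N \<ge> 0\<close> that l by (intro mult_left_mono) auto
    finally show ?thesis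
      using 1 norm_triangle_ineq[of "G z t - F t 0" "F t 0"] by (simp add: algebra_simps)
  qed
  have P_bcontfun: "P z \<in> bcontfun" for z
  proof (rule bcontfun_normI)
    have "continuous_on {0..} (\<lambda>t. integral {0..t} (G z))"
      unfolding continuous_on_eq_continuous_within
    proof
      fix t :: real assume t: "t \<in> {0..}"
      have "((\<lambda>u. integral {0..u} (G z)) has_vector_derivative G z t) (at t within {0..t+1})"
        using t by (intro integral_has_vector_derivative contG') auto
      from has_vector_derivative_at_right_half_line[OF this]
      show "continuous (at t within {0..}) (\<lambda>t. integral {0..t} (G z))"
        using t has_vector_derivative_continuous by auto
    qed
    then have "continuous_on UNIV (\<lambda>t. integral {0..max 0 t} (G z))"
      by (rule continuous_on_compose2) (auto intro!: continuous_intros)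
    then show "continuous_on UNIV (P z)"
      unfolding P_def by (intro continuous_intros) auto
  next
    fix t :: real
    define s where "s = max 0 t"
    have s: "s \<ge> 0" by (simp add: s_def)
    let ?C = "N + \<bar>L\<bar> * norm z"
    have "?C \<ge> 0" using \<open>N \<ge> 0\<close> by simp
    have "norm (integral {0..s} (G z)) \<le> integral {0..s} (\<lambda>r. ?C * exp (l * r))"
      by (rule integral_norm_bound_integral)
        (use G_bound intG int_exp in auto)
    also have "\<dots> = ?C * (exp (l * s) - 1) / l"
      using integral_exp_interval[OF l(1) s] by blast
    also have "\<dots> \<le> ?C * exp (l * s) / l"
      using \<open>?C \<ge> 0\<close> l by (intro divide_right_mono mult_left_mono) auto
    finally have *: "norm (integral {0..s} (G z)) \<le> ?C * exp (l * s) / l" .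
    have "norm (P z t) \<le> exp (- l * s) * (norm x0 + ?C * exp (l * s) / l)"
      unfolding P_def s_def[symmetric] norm_scaleR
      using * norm_triangle_ineq[of x0 "integral {0..s} (G z)"]
      by (intro mult_mono) auto
    also have "\<dots> = exp (- l * s) * norm x0 + ?C / l"
      by (simp add: exp_minus field_simps)
    also have "\<dots> \<le> 1 * norm x0 + ?C / l"
      using s l by (intro add_right_mono mult_right_mono) auto
    finally show "norm (P z t) \<le> norm x0 + ?C / l" by simp
  qed
  define \<Phi> where "\<Phi> z = Bcontfun (P z)" for z
  have \<Phi>: "apply_bcontfun (\<Phi> z) = P z" for z
    unfolding \<Phi>_def by (simp add: Bcontfun_inverse P_bcontfun)
  have contraction: "dist (\<Phi> z) (\<Phi> w) \<le> (\<bar>L\<bar> / l) * dist z w" for z w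
  proof (rule dist_bound)
    fix t :: real
    define s where "s = max 0 t"
    have s: "s \<ge> 0" by (simp add: s_def)
    let ?C = "\<bar>L\<bar> * dist z w"
    have "norm (integral {0..s} (G z) - integral {0..s} (G w))
        = norm (integral {0..s} (\<lambda>r. G z r - G w r))"
      by (simp add: integral_diff intG)
    also have "\<dots> \<le> integral {0..s} (\<lambda>r. ?C * exp (l * r))"
      by (rule integral_norm_bound_integral)
        (use G_diff intG int_exp in \<open>auto intro!: integrable_diff\<close>)
    also have "\<dots> = ?C * (exp (l * s) - 1) / l"
      using integral_exp_interval[OF l(1) s] by blast
    also have "\<dots> \<le> ?C * exp (l * s) / l"
      using l by (intro divide_right_mono mult_left_mono) auto
    finally have *: "norm (integral {0..s} (G z) - integral {0..s} (G w)) \<le> ?C * exp (l * s) / l" .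
    have "dist (P z t) (P w t) = exp (- l * s) * norm (integral {0..s} (G z) - integral {0..s} (G w))"
      unfolding P_def s_def[symmetric] dist_norm
      by (simp flip: scaleR_diff_right)
    also have "\<dots> \<le> exp (- l * s) * (?C * exp (l * s) / l)"
      using * by (intro mult_left_mono) auto
    also have "\<dots> = \<bar>L\<bar> / l * dist z w"
      by (simp add: exp_minus field_simps)
    finally show "dist (\<Phi> z t) (\<Phi> w t) \<le> \<bar>L\<bar> / l * dist z w"
      by (simp add: \<Phi>)
  qed
  have "\<exists>!z. \<Phi> z = z"
    by (rule banach_fix_type[of "\<bar>L\<bar> / l"]) (use l contraction in auto)
  then obtain z where "\<Phi> z = z" by blast
  then have z: "apply_bcontfun z t = P z t" for t
    by (metis \<Phi>)
  define y where "y t = x0 + integral {0..t} (G z)" for t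
  have y: "exp (l * t) *\<^sub>R apply_bcontfun z t = y t" if "t \<ge> 0" for t
    using that by (simp add: z P_def y_def exp_minus flip: scaleR_add_right)
  show thesis
  proof
    show "y 0 = x0" by (simp add: y_def)
  next
    fix t :: real assume t: "0 \<le> t"
    have "((\<lambda>u. integral {0..u} (G z)) has_vector_derivative G z t) (at t within {0..t+1})"
      using t by (intro integral_has_vector_derivative contG') auto
    then have "(y has_vector_derivative G z t) (at t within {0..t+1})"
      unfolding y_def by (auto intro!: derivative_eq_intros)
    moreover have "G z t = F t (y t)"
      unfolding G_def using y[OF t] by simp
    ultimately show "(y has_vector_derivative F t (y t)) (at t within {0..})"
      using has_vector_derivative_at_right_half_line[OF _ t] by simp
  qed
qed


text \<open>Both the error \<open>d\<close> in the vector field and the distance of the initial values enter through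
squares: \<open>2 * u * (L * u + d) \<le> (2 * L + 1) * (u\<^sup>2 + d\<^sup>2)\<close>. Adding \<open>d\<^sup>2\<close> to the squared distance makes the inequality
homogeneous, and for this reason the tubes below are described by \<open>u\<^sup>2 + d\<^sup>2\<close>.\<close>

lemma solutions_stay_close:
  fixes y z :: "real \<Rightarrow> 'a::real_inner"
  assumes "a \<le> b" and y: "continuous_on {a..b} y" and z: "continuous_on {a..b} z"
    and dy: "\<And>t. a < t \<Longrightarrow> t < b \<Longrightarrow> (y has_vector_derivative v t) (at t)"
    and dz: "\<And>t. a < t \<Longrightarrow> t < b \<Longrightarrow> (z has_vector_derivative w t) (at t)"
    and le: "\<And>t. a < t \<Longrightarrow> t < b \<Longrightarrow> norm (v t - w t) \<le> L * norm (y t - z t) + d"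
    and "L \<ge> 0"
  shows "(norm (y b - z b))\<^sup>2 + d\<^sup>2 \<le> exp ((2 * L + 1) * (b - a)) * ((norm (y a - z a))\<^sup>2 + d\<^sup>2)"
proof -
  define S where "S t = (y t - z t) \<bullet> (y t - z t)" for t
  have "S b - (- d\<^sup>2) \<le> exp ((2 * L + 1) * (b - a)) * (S a - (- d\<^sup>2))"
  proof (rule gronwall_affine[where S' = "\<lambda>t. 2 * ((y t - z t) \<bullet> (v t - w t))", OF \<open>a \<le> b\<close>])
    show "continuous_on {a..b} S"
      unfolding S_def by (intro continuous_intros y z)
  next
    fix t assume t: "a < t" "t < b"
    note [derivative_intros] = dy[OF t] dz[OF t]
    have "((\<lambda>t. (y t - z t) \<bullet> (y t - z t)) has_vector_derivative
        ((y t - z t) \<bullet> (v t - w t) + (v t - w t) \<bullet> (y t - z t))) (at t)"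
      by (rule bounded_bilinear.has_vector_derivative[OF bounded_bilinear_inner])
         (intro has_vector_derivative_diff dy[OF t] dz[OF t])+
    then show "(S has_real_derivative 2 * ((y t - z t) \<bullet> (v t - w t))) (at t)"
      by (simp add: S_def[abs_def] inner_commute has_real_derivative_iff_has_vector_derivative)
    define u where "u = norm (y t - z t)"
    have "(y t - z t) \<bullet> (v t - w t) \<le> u * norm (v t - w t)"
      unfolding u_def by (rule norm_cauchy_schwarz)
    also have "\<dots> \<le> u * (L * u + d)"
      using le[OF t] by (intro mult_left_mono) (auto simp: u_def)
    finally have 1: "(y t - z t) \<bullet> (v t - w t) \<le> L * u\<^sup>2 + u * d"
      by (simp add: algebra_simps power2_eq_square)
    have 2: "0 \<le> (u - d)\<^sup>2" "0 \<le> L * d\<^sup>2" using \<open>L \<ge> 0\<close> by auto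
    have "S t = u\<^sup>2" by (simp add: S_def u_def dot_square_norm)
    then show "2 * ((y t - z t) \<bullet> (v t - w t)) \<le> (2 * L + 1) * (S t - (- d\<^sup>2))"
      using 1 2 by (simp add: algebra_simps power2_diff)
  qed
  then show ?thesis by (simp add: S_def dot_square_norm)
qed

lemma C1_has_derivative:
  assumes "C1_on UNIV f"
  shows "(f has_derivative blinfun_apply (Df f x)) (at x)"
proof -
  from assms obtain f' where f': "(f has_derivative f') (at x)"
    by (auto simp: C1_on_def differentiable_def)
  then show ?thesis by (simp add: blinfun_apply_Df)
qed

lemma C1_continuous_on: "C1_on UNIV f \<Longrightarrow> continuous_on S f"
  by (meson C1_has_derivative continuous_at_imp_continuous_on has_derivative_continuous)

lemma C1_continuous_on_Df: "C1_on UNIV f \<Longrightarrow> continuous_on S (Df f)"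
  by (meson C1_on_def continuous_on_subset subset_UNIV)

lemma C1_Lipschitz_on_cball:
  fixes f :: "'a::euclidean_space \<Rightarrow> 'b::real_normed_vector"
  assumes "C1_on UNIV f"
  obtains L where "L \<ge> 0"
    and "\<And>x y. x \<in> cball 0 R \<Longrightarrow> y \<in> cball 0 R \<Longrightarrow> norm (f x - f y) \<le> L * norm (x - y)"
    and "\<And>x. x \<in> cball 0 R \<Longrightarrow> norm (Df f x) \<le> L"
proof -
  have "bounded (Df f ` cball 0 R)"
    by (intro compact_imp_bounded compact_continuous_image C1_continuous_on_Df assms compact_cball)
  then obtain L where "L > 0" and L: "\<And>x. x \<in> cball 0 R \<Longrightarrow> norm (Df f x) \<le> L"
    by (auto simp: bounded_pos)
  show thesis
  proof
    fix x y :: 'a assume xy: "x \<in> cball 0 R" "y \<in> cball 0 R"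
    show "norm (f x - f y) \<le> L * norm (x - y)"
      by (rule differentiable_bound[of "cball 0 R" f "\<lambda>x. blinfun_apply (Df f x)"])
         (use L xy in \<open>auto intro: has_derivative_at_withinI C1_has_derivative assms simp flip: norm_blinfun.rep_eq\<close>)
  qed (use \<open>L > 0\<close> L in auto)
qed

lemma ivp_unique:
  fixes f :: "'a::euclidean_space \<Rightarrow> 'a"
  assumes f: "C1_on UNIV f" and y: "solves_ivp f x t y" and z: "solves_ivp f x t z" and "0 \<le> t"
  shows "y t = z t"
proof -
  have dy: "(y has_vector_derivative f (y s)) (at s within {0..t})"
    and dz: "(z has_vector_derivative f (z s)) (at s within {0..t})" if "s \<in> {0..t}" for s
    using y z that \<open>0 \<le> t\<close> by (auto simp: solves_ivp_def closed_segment_eq_real_ivl)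
  have cy: "continuous_on {0..t} y"
    by (rule continuous_on_vector_derivative, erule dy)
  have cz: "continuous_on {0..t} z"
    by (rule continuous_on_vector_derivative, erule dz)
  have "bounded (y ` {0..t} \<union> z ` {0..t})"
    by (intro bounded_Un[THEN iffD2] conjI compact_imp_bounded compact_continuous_image cy cz compact_Icc)
  then obtain R where R: "\<And>x. x \<in> y ` {0..t} \<union> z ` {0..t} \<Longrightarrow> norm x \<le> R"
    unfolding bounded_iff by blast
  obtain L where L: "L \<ge> 0"
      "\<And>x y. x \<in> cball 0 R \<Longrightarrow> y \<in> cball 0 R \<Longrightarrow> norm (f x - f y) \<le> L * norm (x - y)"
    using C1_Lipschitz_on_cball[OF f] by metis
  have "(norm (y t - z t))\<^sup>2 + 0\<^sup>2 \<le> exp ((2 * L + 1) * (t - 0)) * ((norm (y 0 - z 0))\<^sup>2 + 0\<^sup>2)"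
  proof (rule solutions_stay_close[OF \<open>0 \<le> t\<close> cy cz])
    fix s assume "0 < s" "s < t"
    then have "at s within {0..t} = at s"
      by (intro at_within_interior) (simp add: interior_atLeastAtMost_real)
    then show "(y has_vector_derivative f (y s)) (at s)" "(z has_vector_derivative f (z s)) (at s)"
      using dy[of s] dz[of s] \<open>0 < s\<close> \<open>s < t\<close> by auto
    show "norm (f (y s) - f (z s)) \<le> L * norm (y s - z s) + 0"
      using L(2)[of "y s" "z s"] R \<open>0 < s\<close> \<open>s < t\<close> by auto
  qed (use L in auto)
  moreover have "y 0 = z 0" using y z by (simp add: solves_ivp_def)
  ultimately show ?thesis by simp
qed

lemma flow_eqI:
  fixes f :: "'a::euclidean_space \<Rightarrow> 'a"
  assumes "C1_on UNIV f" and "solves_ivp f x t y" and "0 \<le> t"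
  shows "flow f t x = y t"
  unfolding flow_def using assms by (intro the_equality) (auto intro: ivp_unique)

definition forward_solution :: "('a::real_normed_vector \<Rightarrow> 'a) \<Rightarrow> (real \<Rightarrow> 'a) \<Rightarrow> bool"
  where "forward_solution f y \<longleftrightarrow>
    (\<forall>t\<ge>0. (y has_vector_derivative f (y t)) (at t within {0..}))"

lemma forward_solution_solves_ivp:
  assumes "forward_solution f y" and "0 \<le> t"
  shows "solves_ivp f (y 0) t y"
proof -
  have "(y has_vector_derivative f (y s)) (at s within {0..t})" if "0 \<le> s" for s
    by (rule has_vector_derivative_within_subset[of y _ _ "{0..}"])
       (use assms that in \<open>auto simp: forward_solution_def\<close>)
  with \<open>0 \<le> t\<close> show ?thesis
    by (auto simp: solves_ivp_def closed_segment_eq_real_ivl)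
qed

lemma forward_solution_flow:
  fixes f :: "'a::euclidean_space \<Rightarrow> 'a"
  assumes "C1_on UNIV f" and "forward_solution f y" and "0 \<le> t"
  shows "flow_exists f t (y 0)" and "flow f t (y 0) = y t"
  using forward_solution_solves_ivp[OF assms(2,3)] flow_eqI[OF assms(1) _ assms(3)]
  by (auto simp: flow_exists_def)

lemma flow_forward_solution:
  fixes f :: "'a::euclidean_space \<Rightarrow> 'a"
  assumes f: "C1_on UNIV f" and ex: "\<And>t. 0 \<le> t \<Longrightarrow> flow_exists f t x"
  shows "forward_solution f (\<lambda>t. flow f t x)" and "flow f 0 x = x"
proof -
  have *: "flow f s x = y s" if y: "solves_ivp f x t y" and "0 \<le> s" "s \<le> t" for s t y
  proof (rule flow_eqI[OF f])
    have "(y has_vector_derivative f (y r)) (at r within {0..s})" if "0 \<le> r" "r \<le> s" for r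
      by (rule has_vector_derivative_within_subset[of y _ _ "{0..t}"])
         (use y that \<open>s \<le> t\<close> in \<open>auto simp: solves_ivp_def closed_segment_eq_real_ivl\<close>)
    then show "solves_ivp f x s y"
      using y \<open>0 \<le> s\<close> by (auto simp: solves_ivp_def closed_segment_eq_real_ivl)
  qed fact
  show "flow f 0 x = x"
  proof -
    obtain y where y: "solves_ivp f x 0 y" using ex[of 0] by (auto simp: flow_exists_def)
    show ?thesis using *[OF y, of 0] y by (simp add: solves_ivp_def)
  qed
  show "forward_solution f (\<lambda>t. flow f t x)"
    unfolding forward_solution_def
  proof (intro allI impI)
    fix t :: real assume t: "0 \<le> t"
    then obtain y where y: "solves_ivp f x (t + 1) y"
      using ex[of "t + 1"] by (auto simp: flow_exists_def)
    then have "(y has_vector_derivative f (y t)) (at t within {0..t+1})"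
      using t by (auto simp: solves_ivp_def closed_segment_eq_real_ivl)
    then have "((\<lambda>t. flow f t x) has_vector_derivative f (flow f t x)) (at t within {0..t+1})"
      using *[OF y] t
      by (auto intro: has_vector_derivative_transform)
    then show "((\<lambda>t. flow f t x) has_vector_derivative f (flow f t x)) (at t within {0..})"
      using has_vector_derivative_at_right_half_line t by blast
  qed
qed

text \<open>The projection to a ball is Lipschitz with constant 1, so the composed field is globally Lipschitz and
has global solutions. As long as such a solution stays in the ball it solves the original equation.\<close>

lemma cutoff_global_solution:
  fixes g :: "'a::euclidean_space \<Rightarrow> 'a"
  assumes g: "C1_on UNIV g" and "0 \<le> R"
  obtains y where "y 0 = x0"
    and "\<And>t. 0 \<le> t \<Longrightarrow>
      (y has_vector_derivative g (closest_point (cball 0 R) (y t))) (at t within {0..})"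
proof -
  let ?c = "closest_point (cball (0::'a) R)"
  have c: "?c x \<in> cball 0 R" for x
    using \<open>0 \<le> R\<close> by (intro closest_point_in_set) auto
  have contc: "continuous_on UNIV ?c"
    using \<open>0 \<le> R\<close> by (intro continuous_on_closest_point) auto
  obtain L where L: "L \<ge> 0"
      "\<And>x y. x \<in> cball 0 R \<Longrightarrow> y \<in> cball 0 R \<Longrightarrow> norm (g x - g y) \<le> L * norm (x - y)"
    using C1_Lipschitz_on_cball[OF g] by metis
  show thesis
  proof (rule global_solution_Lipschitz[of "\<lambda>t x. g (?c x)" L "norm (g (?c 0))" x0])
    fix z :: "real \<Rightarrow> 'a" assume "continuous_on {0..} z"
    then show "continuous_on {0..} (\<lambda>t. g (?c (z t)))"
      by (intro continuous_on_compose2[OF C1_continuous_on[OF g, of UNIV]]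
          continuous_on_compose2[OF contc]) auto
  next
    fix x y :: 'a
    have "norm (g (?c x) - g (?c y)) \<le> L * norm (?c x - ?c y)"
      by (intro L c)
    also have "\<dots> \<le> L * norm (x - y)"
      using L(1) closest_point_lipschitz[of "cball (0::'a) R" x y] \<open>0 \<le> R\<close>
      by (intro mult_left_mono) (auto simp: dist_norm)
    finally show "norm (g (?c x) - g (?c y)) \<le> L * norm (x - y)" .
  qed (use that in auto)
qed

section \<open>An adapted quadratic form for a Hurwitz matrix\<close>

primrec shift_prod :: "complex^'n^'n \<Rightarrow> complex list \<Rightarrow> complex^'n \<Rightarrow> complex^'n" where
  "shift_prod A [] v = v"
| "shift_prod A (m # ms) v = shift_prod A ms (A *v v - m *s v)"

lemma shift_prod_append: "shift_prod A (xs @ ys) v = shift_prod A ys (shift_prod A xs v)"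
  by (induction xs arbitrary: v) auto

lemma shift_prod_commute:
  "shift_prod A ms (A *v v - m *s v) = A *v shift_prod A ms v - m *s shift_prod A ms v"
proof (induction ms arbitrary: v)
  case (Cons k ms)
  have *: "A *v (A *v v - m *s v) - k *s (A *v v - m *s v)
      = A *v (A *v v - k *s v) - m *s (A *v v - k *s v)"
    by (simp add: matrix_vector_mult_diff_distrib vector_scalar_commute vector_ssub_ldistrib
        vector_smult_assoc mult.commute)
  show ?case by (simp only: shift_prod.simps * Cons.IH)
qed simp

lemma linearly_dependent_sequence:
  fixes a :: "nat \<Rightarrow> 'a::euclidean_space"
  shows "\<exists>r. (\<exists>i\<le>DIM('a). r i \<noteq> 0) \<and> (\<Sum>i\<le>DIM('a). r i *\<^sub>R a i) = 0"
proof (cases "inj_on a {..DIM('a)}")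
  case True
  have "card (a ` {..DIM('a)}) > DIM('a)"
    using True by (simp add: card_image)
  then have "dependent (a ` {..DIM('a)})"
    using dependent_biggerset by blast
  then obtain u where u: "\<exists>v\<in>a ` {..DIM('a)}. u v \<noteq> 0" "(\<Sum>v\<in>a ` {..DIM('a)}. u v *\<^sub>R v) = 0"
    by (auto simp: dependent_finite)
  then have "(\<Sum>i\<le>DIM('a). u (a i) *\<^sub>R a i) = 0"
    using True by (simp add: sum.reindex)
  with u(1) show ?thesis by (intro exI[of _ "u \<circ> a"]) auto
next
  case False
  then obtain i j where ij: "i \<le> DIM('a)" "j \<le> DIM('a)" "i \<noteq> j" "a i = a j"
    by (auto simp: inj_on_def)
  define r where "r = (\<lambda>k. (if k = i then 1 else 0) - (if k = j then 1 else 0) :: real)"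
  have "(\<Sum>k\<le>DIM('a). r k *\<^sub>R a k) = (\<Sum>k\<le>DIM('a). (if k = i then a k else 0) - (if k = j then a k else 0))"
    by (intro sum.cong) (auto simp: r_def)
  also have "\<dots> = 0"
    using ij by (simp add: sum_subtractf)
  finally have "(\<Sum>k\<le>DIM('a). r k *\<^sub>R a k) = 0" .
  moreover have "r i \<noteq> 0" using ij by (simp add: r_def)
  ultimately show ?thesis using ij(1) by blast
qed

text \<open>Real matrices embed into complex ones, and a complex polynomial that annihilates the matrix
splits into linear factors. Evaluation at a matrix is set up by hand, vector by vector, only to
convert such a polynomial into a product of shifts \<open>A - m\<close>.\<close>

definition poly_at :: "complex^'n^'n \<Rightarrow> complex poly \<Rightarrow> complex^'n \<Rightarrow> complex^'n"
  where "poly_at A p v = (\<Sum>i\<le>degree p. coeff p i *s ((*v) A ^^ i) v)"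

lemma poly_at_upto:
  assumes "degree p \<le> N"
  shows "poly_at A p v = (\<Sum>i\<le>N. coeff p i *s ((*v) A ^^ i) v)"
  unfolding poly_at_def
  using assms by (intro sum.mono_neutral_left) (auto simp: coeff_eq_0)

lemma poly_at_root_factor:
  "poly_at A ([:- m, 1:] * q) v = poly_at A q (A *v v - m *s v)"
proof -
  define N where "N = degree q"
  have lin: "((*v) A ^^ i) (A *v v - m *s v) = ((*v) A ^^ Suc i) v - m *s ((*v) A ^^ i) v" for i
  proof (induction i)
    case (Suc i)
    then show ?case
      by (simp add: matrix_vector_mult_diff_distrib vector_scalar_commute)
  qed simp
  have "degree ([:- m, 1:] * q) \<le> Suc N"
    using degree_mult_le[of "[:- m, 1:]" q] by (simp add: N_def)
  then have "poly_at A ([:- m, 1:] * q) v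
      = (\<Sum>i\<le>Suc N. coeff ([:- m, 1:] * q) i *s ((*v) A ^^ i) v)"
    by (rule poly_at_upto)
  also have "\<dots> = (\<Sum>i\<le>Suc N. coeff (pCons 0 q) i *s ((*v) A ^^ i) v)
      - (\<Sum>i\<le>Suc N. (m * coeff q i) *s ((*v) A ^^ i) v)"
    by (simp add: sum_subtractf[symmetric] vector_sadd_rdistrib vector_ssub_ldistrib algebra_simps
       del: sum.atMost_Suc)
  also have "(\<Sum>i\<le>Suc N. coeff (pCons 0 q) i *s ((*v) A ^^ i) v)
      = (\<Sum>i\<le>N. coeff q i *s ((*v) A ^^ Suc i) v)"
    by (subst sum.atMost_Suc_shift) simp
  also have "(\<Sum>i\<le>Suc N. (m * coeff q i) *s ((*v) A ^^ i) v)
      = (\<Sum>i\<le>N. (m * coeff q i) *s ((*v) A ^^ i) v)"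
    by (simp add: N_def coeff_eq_0)
  also have "(\<Sum>i\<le>N. coeff q i *s ((*v) A ^^ Suc i) v) - \<dots>
      = (\<Sum>i\<le>N. coeff q i *s (((*v) A ^^ i) (A *v v - m *s v)))"
    unfolding lin sum_subtractf[symmetric]
    by (simp add: vector_ssub_ldistrib vector_smult_assoc mult.commute)
  also have "\<dots> = poly_at A q (A *v v - m *s v)"
    by (simp add: poly_at_def N_def)
  finally show ?thesis .
qed

lemma poly_at_factors:
  "poly_at A (\<Prod>m\<leftarrow>ms. [:- m, 1:]) v = shift_prod A ms v"
proof (induction ms arbitrary: v)
  case Nil
  then show ?case by (simp add: poly_at_def)
next
  case (Cons m ms)
  then show ?case by (simp only: list.map prod_list.Cons poly_at_root_factor shift_prod.simps)
qed

text \<open>The powers of \<open>A\<close> up to the dimension of the space of matrices are linearly dependent, and the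
fundamental theorem of algebra factors the resulting polynomial.\<close>

lemma matrix_annihilated_by_shifts:
  fixes A :: "complex^'n^'n"
  obtains ms where "\<And>v. shift_prod A ms v = 0"
proof -
  define pow where "pow i = (((**) A) ^^ i) (mat 1)" for i
  have pow: "pow i *v v = ((*v) A ^^ i) v" for i v
    by (induction i) (simp_all add: pow_def matrix_vector_mul_assoc[symmetric])
  define N where "N = DIM(complex^'n^'n)"
  obtain r i0 where r: "i0 \<le> N" "r i0 \<noteq> 0" "(\<Sum>i\<le>N. r i *\<^sub>R pow i) = 0"
    using linearly_dependent_sequence[of pow] unfolding N_def by blast
  define p where "p = (\<Sum>i\<le>N. monom (complex_of_real (r i)) i)"
  have coeff: "coeff p i = (if i \<le> N then complex_of_real (r i) else 0)" for i
    by (auto simp: p_def coeff_sum)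
  have "coeff p i0 \<noteq> 0" using r by (simp add: coeff)
  then have "p \<noteq> 0" by auto
  have "degree p \<le> N" by (rule degree_le) (simp add: coeff)
  have p0: "poly_at A p v = 0" for v
  proof -
    have "poly_at A p v = (\<Sum>i\<le>N. r i *\<^sub>R (pow i *v v))"
      unfolding poly_at_upto[OF \<open>degree p \<le> N\<close>] pow
      by (intro sum.cong) (auto simp: coeff vec_eq_iff scaleR_conv_of_real[where 'a=complex])
    also have "\<dots> = (\<Sum>i\<le>N. r i *\<^sub>R pow i) *v v"
      by (simp add: vec_eq_iff matrix_vector_mult_def sum_distrib_right scaleR_sum_right
          sum.swap[of _ "{..N}"])
    also have "\<dots> = 0" by (simp add: r(3))
    finally show ?thesis .
  qed
  obtain ms where ms: "mset ms = proots p" using ex_mset by blast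
  have "p = smult (lead_coeff p) (\<Prod>x\<in>#proots p. [:- x, 1:])"
    by (rule complex_poly_decompose_multiset[symmetric])
  also have "(\<Prod>x\<in>#proots p. [:- x, 1:]) = (\<Prod>m\<leftarrow>ms. [:- m, 1:])"
    by (subst prod_mset_prod_list[symmetric]) (simp add: ms)
  finally have p: "p = smult (lead_coeff p) (\<Prod>m\<leftarrow>ms. [:- m, 1:])" .
  have "shift_prod A ms v = 0" for v
  proof -
    have "poly_at A p v = lead_coeff p *s poly_at A (\<Prod>m\<leftarrow>ms. [:- m, 1:]) v"
      apply (subst p)
      unfolding poly_at_def using \<open>p \<noteq> 0\<close>
      by (simp add: vec_eq_iff sum_distrib_left mult.assoc)
    then show ?thesis
      using p0[of v] \<open>p \<noteq> 0\<close> by (simp add: poly_at_factors)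
  qed
  then show thesis by (rule that)
qed

text \<open>In a shortest annihilating product each factor \<open>A - m\<close> can be moved to the front; the
product of the others does not vanish, and its nonzero values are eigenvectors for \<open>m\<close>.\<close>

lemma matrix_annihilated_by_eigenvalue_shifts:
  fixes A :: "complex^'n^'n"
  obtains ms where "\<And>v. shift_prod A ms v = 0"
    and "\<And>m. m \<in> set ms \<Longrightarrow> \<exists>w. w \<noteq> 0 \<and> A *v w = m *s w"
proof -
  obtain ms0 where "\<forall>v. shift_prod A ms0 v = 0"
    using matrix_annihilated_by_shifts by blast
  then obtain ms where ms: "\<forall>v. shift_prod A ms v = 0"
    and min: "\<And>ks. \<forall>v. shift_prod A ks v = 0 \<Longrightarrow> length ms \<le> length ks"
    using ex_has_least_nat[of "\<lambda>ms. \<forall>v. shift_prod A ms v = 0" ms0 length] by blast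
  have "\<exists>w. w \<noteq> 0 \<and> A *v w = m *s w" if m: "m \<in> set ms" for m
  proof -
    obtain xs ys where split: "ms = xs @ m # ys"
      using split_list[OF m] by blast
    then have "\<not> (\<forall>v. shift_prod A (xs @ ys) v = 0)"
      using min[of "xs @ ys"] by auto
    then obtain v where v: "shift_prod A (xs @ ys) v \<noteq> 0" by blast
    have "A *v shift_prod A (xs @ ys) v - m *s shift_prod A (xs @ ys) v = shift_prod A ms v"
      by (simp add: split shift_prod_append shift_prod_commute)
    then have "A *v shift_prod A (xs @ ys) v = m *s shift_prod A (xs @ ys) v"
      using ms by simp
    with v show ?thesis by blast
  qed
  with ms that show thesis by blast
qed

text \<open>The form is built along the list. With \<open>w = A v - m v\<close> one has \<open>v \<bullet> A v = Re m * |v|\<^sup>2 + v \<bullet> w\<close>; the mixed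
term costs half of the decay of \<open>|v|\<^sup>2\<close> and a multiple of \<open>|w|\<^sup>2\<close>, and the latter is absorbed by
the decay of the form \<open>b'\<close> for the rest of the list, evaluated at \<open>w\<close> and weighted by \<open>c\<close>. What cannot be
absorbed is the image under the whole product, which vanishes in the application.\<close>

lemma form_decreasing_up_to_shifts:
  fixes A :: "complex^'n^'n"
  assumes "\<And>m. m \<in> set ms \<Longrightarrow> Re m < 0"
  shows "\<exists>b a K. bilinear b \<and> (\<forall>u v. b u v = b v u) \<and> 0 < a \<and> 0 \<le> K \<and> (\<forall>v. 0 \<le> b v v) \<and>
    (\<forall>v. (norm v)\<^sup>2 \<le> b v v + (norm (shift_prod A ms v))\<^sup>2) \<and>
    (\<forall>v. b v (A *v v) \<le> - a * b v v + K * (norm (shift_prod A ms v))\<^sup>2)"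
  using assms
proof (induction ms)
  case Nil
  have "bilinear (\<lambda>u v. 0 :: real)"
    by (simp add: bilinear_def linear_zero)
  then show ?case
    by (intro exI[of _ "\<lambda>u v. 0"] exI[of _ "1::real"] exI[of _ "0::real"]) simp
next
  case (Cons m ms)
  then obtain b' a' K' where bil: "bilinear b'" and sym: "\<And>u v. b' u v = b' v u"
    and "0 < a'" "0 \<le> K'" and pos: "\<And>v. 0 \<le> b' v v"
    and lower: "\<And>v. (norm v)\<^sup>2 \<le> b' v v + (norm (shift_prod A ms v))\<^sup>2"
    and decr: "\<And>v. b' v (A *v v) \<le> - a' * b' v v + K' * (norm (shift_prod A ms v))\<^sup>2"
    by (metis list.set_intros(2))
  define a0 where "a0 = - Re m"
  have "a0 > 0" using Cons.prems by (simp add: a0_def)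
  define B where "B v = A *v v - m *s v" for v
  \<comment> \<open>This weight makes \<open>c * a'\<close> twice the coefficient \<open>1 / (2 * a0)\<close> of \<open>|w|\<^sup>2\<close> in the bound for \<open>v \<bullet> w\<close>,
    so that half of the decay of \<open>b'\<close> is left over.\<close>
  define c where "c = 1 / (a' * a0)"
  have "c > 0" using \<open>0 < a'\<close> \<open>a0 > 0\<close> by (simp add: c_def)
  define b where "b u v = u \<bullet> v + c * b' (B u) (B v)" for u v
  have linB: "linear B"
    by (rule linearI)
      (simp_all add: B_def vec_eq_iff matrix_vector_mult_def algebra_simps sum.distrib scaleR_sum_right)
  have "bilinear b"
    using bil linB unfolding b_def bilinear_def
    by (auto simp: linear_iff inner_add algebra_simps)
  moreover have "\<forall>u v. b u v = b v u"
    by (simp add: b_def sym inner_commute)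
  moreover have "\<forall>v. 0 \<le> b v v"
    using \<open>c > 0\<close> pos by (simp add: b_def)
  moreover have "\<forall>v. (norm v)\<^sup>2 \<le> b v v + (norm (shift_prod A (m # ms) v))\<^sup>2"
    using \<open>c > 0\<close> pos by (simp add: b_def dot_square_norm)
  moreover have "b v (A *v v) \<le> - (min a0 a' / 2) * b v v
      + (1 / (2 * a0) + c * K') * (norm (shift_prod A (m # ms) v))\<^sup>2" for v
  proof -
    define w where "w = B v"
    define k where "k = 1 / (2 * a0)"
    define n where "n = (norm (shift_prod A ms w))\<^sup>2"
    have "A *v v = m *s v + w" by (simp add: w_def B_def)
    moreover have "v \<bullet> (m *s v) = - a0 * (norm v)\<^sup>2"
    proof -
      have "x \<bullet> (m * x) = Re m * (x \<bullet> x)" for x :: complex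
        by (simp add: inner_complex_def algebra_simps)
      then show ?thesis
        by (simp add: dot_square_norm[symmetric] inner_vec_def sum_distrib_left a0_def)
    qed
    moreover have "v \<bullet> w \<le> a0 / 2 * (norm v)\<^sup>2 + 1 / (2 * a0) * (norm w)\<^sup>2"
    proof -
      have "0 \<le> (a0 * norm v - norm w)\<^sup>2 / (2 * a0)" using \<open>a0 > 0\<close> by simp
      then have "norm v * norm w \<le> a0 / 2 * (norm v)\<^sup>2 + 1 / (2 * a0) * (norm w)\<^sup>2"
        using \<open>a0 > 0\<close> by (simp add: power2_eq_square field_simps)
      then show ?thesis using norm_cauchy_schwarz[of v w] by linarith
    qed
    moreover have "1 / (2 * a0) * (norm w)\<^sup>2 \<le> 1 / (2 * a0) * (b' w w + n)"
      using lower[of w] \<open>a0 > 0\<close> unfolding n_def by (intro mult_left_mono) auto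
    ultimately have 1: "v \<bullet> (A *v v) \<le> - (a0 / 2) * (norm v)\<^sup>2 + k * (b' w w + n)"
      by (simp add: inner_add_right k_def)
    have "B (A *v v) = A *v w"
      by (simp add: w_def B_def matrix_vector_mult_diff_distrib vector_scalar_commute)
    then have 2: "c * b' (B v) (B (A *v v)) \<le> c * (- a' * b' w w + K' * n)"
      using decr[of w] \<open>c > 0\<close> unfolding n_def w_def[symmetric] by (intro mult_left_mono) auto
    have ca: "c * a' = 2 * k" using \<open>0 < a'\<close> \<open>a0 > 0\<close> by (simp add: c_def k_def)
    have 3: "c * (- a' * b' w w + K' * n) = - (2 * k) * b' w w + c * K' * n"
      by (simp only: ca[symmetric]) (simp add: algebra_simps)
    have "b v (A *v v) \<le> - (a0 / 2) * (norm v)\<^sup>2 - k * b' w w + (k + c * K') * n"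
      using 1 2 unfolding b_def 3 by (simp add: algebra_simps)
    also have "k * b' w w = a' / 2 * (c * b' w w)"
      using \<open>0 < a'\<close> \<open>a0 > 0\<close> by (simp add: c_def k_def)
    also have "- (a0 / 2) * (norm v)\<^sup>2 - a' / 2 * (c * b' w w) + (k + c * K') * n
       \<le> - (min a0 a' / 2) * b v v + (k + c * K') * n"
    proof -
      have "min a0 a' / 2 * (norm v)\<^sup>2 \<le> a0 / 2 * (norm v)\<^sup>2"
        by (intro mult_right_mono) auto
      moreover have "min a0 a' / 2 * (c * b' w w) \<le> a' / 2 * (c * b' w w)"
        using \<open>c > 0\<close> pos by (intro mult_right_mono) auto
      ultimately show ?thesis
        by (simp add: b_def w_def[symmetric] dot_square_norm distrib_left)
    qed
    finally show ?thesis by (simp add: n_def w_def B_def k_def)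
  qed
  ultimately show ?case
    using \<open>0 < a'\<close> \<open>0 \<le> K'\<close> \<open>a0 > 0\<close> \<open>c > 0\<close>
    by (intro exI[of _ b] exI[of _ "min a0 a' / 2"] exI[of _ "1 / (2 * a0) + c * K'"]) auto
qed

lemma Hurwitz_quadratic_form:
  fixes A :: "real^'n^'n"
  assumes "Hurwitz A"
  obtains b a where "bilinear b" and "\<And>x y. b x y = b y x" and "\<And>x. (norm x)\<^sup>2 \<le> b x x"
    and "0 < a" and "\<And>x. b x (A *v x) \<le> - a * b x x"
proof -
  define Ac where "Ac = (\<chi> i j. complex_of_real (A $ i $ j))"
  define cvec where "cvec x = (\<chi> i. complex_of_real (x $ i))" for x :: "real^'n"
  obtain ms where ms: "\<And>v. shift_prod Ac ms v = 0"
    and eig: "\<And>m. m \<in> set ms \<Longrightarrow> \<exists>w. w \<noteq> 0 \<and> Ac *v w = m *s w"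
    using matrix_annihilated_by_eigenvalue_shifts by blast
  have "Re m < 0" if "m \<in> set ms" for m
    using assms eig[OF that] by (auto simp: Hurwitz_def complex_eigenvalue_def Ac_def)
  then obtain b a where b: "bilinear b" "\<And>u v. b u v = b v u" "0 < a"
      "\<And>v. (norm v)\<^sup>2 \<le> b v v" "\<And>v. b v (Ac *v v) \<le> - a * b v v"
    using form_decreasing_up_to_shifts[of ms Ac] by (auto simp: ms)
  have lin: "linear cvec"
    by (rule linearI) (simp_all add: cvec_def vec_eq_iff scaleR_conv_of_real[where 'a=complex])
  have Ac: "cvec (A *v x) = Ac *v cvec x" for x
    by (simp add: cvec_def Ac_def vec_eq_iff matrix_vector_mult_def)
  have norm: "norm (cvec x) = norm x" for x
    by (simp add: cvec_def norm_vec_def)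
  show thesis
  proof
    show "bilinear (\<lambda>x y. b (cvec x) (cvec y))"
      using b(1) lin by (auto simp: bilinear_def linear_iff)
    show "(norm x)\<^sup>2 \<le> b (cvec x) (cvec x)" for x
      using b(4)[of "cvec x"] by (simp add: norm)
  qed (use b Ac in auto)
qed


section \<open>Contraction near a stable equilibrium\<close>

locale lyapunov_form =
  fixes b :: "'a::euclidean_space \<Rightarrow> 'a \<Rightarrow> real" and M :: real
  assumes bilinear: "bilinear b" and sym: "b x y = b y x"
    and lower: "(norm x)\<^sup>2 \<le> b x x"
    and upper: "\<bar>b x y\<bar> \<le> M * norm x * norm y" and M_pos: "0 < M"
begin

lemma bounded_bilinear: "bounded_bilinear b"
  using bilinear by (simp add: bilinear_conv_bounded_bilinear)

lemma zero [simp]: "b 0 x = 0" "b x 0 = 0"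
  using bilinear by (simp_all add: bilinear_lzero bilinear_rzero)

lemma diag_nonneg: "0 \<le> b x x"
  using lower[of x] by (meson order_trans zero_le_power2)

lemma diag_upper: "b x x \<le> M * (norm x)\<^sup>2"
  using upper[of x x] by (simp add: power2_eq_square)

lemma continuous_on_b [continuous_intros]:
  fixes f g :: "'c::topological_space \<Rightarrow> 'a"
  shows "continuous_on S f \<Longrightarrow> continuous_on S g \<Longrightarrow> continuous_on S (\<lambda>t. b (f t) (g t))"
  by (rule bounded_bilinear.continuous_on[OF bounded_bilinear])

lemma has_real_derivative_diag:
  assumes "(w has_vector_derivative v) (at t within S)"
  shows "((\<lambda>t. b (w t) (w t)) has_real_derivative 2 * b (w t) v) (at t within S)"
  using bounded_bilinear.has_vector_derivative[OF bounded_bilinear assms assms]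
  by (simp add: has_real_derivative_iff_has_vector_derivative sym[of v])

text \<open>The identity \<open>b (u x + v y) = u b(x) + v b(y) - u v b(x - y)\<close> for \<open>u + v = 1\<close>, where \<open>b(x)\<close> stands for \<open>b x x\<close>,
shows that a positive quadratic form is convex.\<close>

lemma sublevel_convex: "convex {x. b x x \<le> r}"
proof (rule convexI)
  fix x y :: 'a and u v :: real
  assume xy: "x \<in> {x. b x x \<le> r}" "y \<in> {x. b x x \<le> r}" and uv: "0 \<le> u" "0 \<le> v" "u + v = 1"
  have "0 \<le> u * v * b (x - y) (x - y)"
    using uv diag_nonneg by simp
  moreover have "b (u *\<^sub>R x + v *\<^sub>R y) (u *\<^sub>R x + v *\<^sub>R y)
      = u * b x x + v * b y y - u * v * b (x - y) (x - y)"
  proof -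
    have v: "v = 1 - u" using uv by simp
    show ?thesis
      unfolding v
      by (simp add: bilinear_radd[OF bilinear] bilinear_ladd[OF bilinear] bilinear_rmul[OF bilinear]
          bilinear_lmul[OF bilinear] bilinear_rsub[OF bilinear] bilinear_lsub[OF bilinear]
          sym[of y x] algebra_simps)
  qed
  moreover have "u * b x x + v * b y y \<le> u * r + v * r"
    using xy uv by (intro add_mono mult_left_mono) auto
  moreover have "u * r + v * r = r" using uv by (simp flip: distrib_right)
  ultimately show "u *\<^sub>R x + v *\<^sub>R y \<in> {x. b x x \<le> r}" by simp
qed

lemma sublevel_compact: "compact {x. b x x \<le> r}"
proof -
  have "closed {x. b x x \<le> r}"
    by (intro closed_Collect_le continuous_intros)
  moreover have "bounded {x. b x x \<le> r}"
    unfolding bounded_iff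
  proof (intro exI ballI)
    fix x assume "x \<in> {x. b x x \<le> r}"
    then have "(norm x)\<^sup>2 \<le> r" using lower[of x] by simp
    then show "norm x \<le> sqrt r" by (rule real_le_rsqrt)
  qed
  ultimately show ?thesis by (simp add: compact_eq_bounded_closed)
qed

text \<open>The condition is imposed on the derivative rather than on \<open>g\<close>: it then passes to C1-small
perturbations (\<open>contracts_on_perturb\<close>), bounds solutions of the variational equation, and by the mean value theorem bounds
differences of trajectories (\<open>contracts_on_increment\<close>).\<close>

definition contracts_on :: "real \<Rightarrow> 'a set \<Rightarrow> ('a \<Rightarrow> 'a) \<Rightarrow> bool"
  where "contracts_on a S g \<longleftrightarrow> (\<forall>x\<in>S. \<forall>u. b u (blinfun_apply (Df g x) u) \<le> - a * b u u)"

lemma contracts_on_increment: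
  assumes "contracts_on a S g" and g: "C1_on UNIV g" and "convex S" and "x \<in> S" "y \<in> S"
  shows "b (y - x) (g y - g x) \<le> - a * b (y - x) (y - x)"
proof -
  define u where "u = y - x"
  define h where "h s = b u (g (x + s *\<^sub>R u))" for s
  have line: "x + s *\<^sub>R u \<in> S" if "0 \<le> s" "s \<le> 1" for s
  proof -
    have "x + s *\<^sub>R u = (1 - s) *\<^sub>R x + s *\<^sub>R y" by (simp add: u_def algebra_simps)
    then show ?thesis using assms that by (simp add: convex_alt)
  qed
  have d: "(h has_real_derivative b u (Df g (x + s *\<^sub>R u) u)) (at s)" for s
  proof -
    have "((\<lambda>s. g (x + s *\<^sub>R u)) has_derivative (\<lambda>r. blinfun_apply (Df g (x + s *\<^sub>R u)) (r *\<^sub>R u))) (at s)"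
      by (rule has_derivative_compose[OF _ C1_has_derivative[OF g], where f = "\<lambda>s. x + s *\<^sub>R u"])
         (auto intro!: derivative_eq_intros)
    from bounded_linear.has_derivative[OF bounded_bilinear.bounded_linear_right[OF bounded_bilinear, of u] this]
    have "(h has_derivative (\<lambda>r. b u (Df g (x + s *\<^sub>R u) u) * r)) (at s)"
      by (simp add: mult.commute h_def[abs_def] blinfun.scaleR_right bilinear_rmul[OF bilinear])
    then show ?thesis
      by (simp add: has_field_derivative_def)
  qed
  then obtain s where s: "0 < s" "s < 1" "h 1 - h 0 = (1 - 0) * b u (Df g (x + s *\<^sub>R u) u)"
    using MVT2[of 0 1 h "\<lambda>s. b u (Df g (x + s *\<^sub>R u) u)"] by auto
  then have "h 1 - h 0 \<le> - a * b u u"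
    using assms(1) line[of s] by (auto simp: contracts_on_def)
  then show ?thesis
    by (simp add: h_def u_def bilinear_rsub[OF bilinear])
qed

lemma contracts_on_perturb:
  assumes "contracts_on a S f" and "\<And>x. x \<in> S \<Longrightarrow> norm (Df g x - Df f x) \<le> e" and "M * e \<le> a - a'"
    and "a' \<le> a"
  shows "contracts_on a' S g"
  unfolding contracts_on_def
proof (intro ballI allI)
  fix x u assume x: "x \<in> S"
  have "b u ((Df g x - Df f x) u) \<le> M * norm u * norm ((Df g x - Df f x) u)"
    using upper by (meson abs_le_D1)
  also have "\<dots> \<le> M * norm u * (e * norm u)"
    using M_pos norm_blinfun[of "Df g x - Df f x" u] mult_right_mono[OF assms(2)[OF x], of "norm u"]
    by (intro mult_left_mono) auto
  also have "\<dots> = (M * e) * (norm u)\<^sup>2" by (simp add: power2_eq_square)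
  also have "\<dots> \<le> (a - a') * (norm u)\<^sup>2"
    using assms(3) by (intro mult_right_mono) auto
  also have "\<dots> \<le> (a - a') * b u u"
    using assms(4) lower by (intro mult_left_mono) auto
  finally have "b u (Df g x u) - b u (Df f x u) \<le> (a - a') * b u u"
    by (simp add: blinfun.diff_left bilinear_rsub[OF bilinear])
  moreover have "b u (Df f x u) \<le> - a * b u u"
    using assms(1) x by (auto simp: contracts_on_def)
  ultimately show "b u (Df g x u) \<le> - a' * b u u" by (simp add: algebra_simps)
qed

end

text \<open>Near 0 the derivative of \<open>f\<close> is a small perturbation of the derivative at 0, which is the derivative
of its own linear part, at every point.\<close>

lemma stable_equilibrium_form:
  assumes "f \<in> Fst"
  obtains b M a r where "lyapunov_form b M" and "0 < a" and "0 < r"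
    and "lyapunov_form.contracts_on b a {x. b x x \<le> r\<^sup>2} f"
proof -
  from assms have f: "C1_on UNIV f" and H: "Hurwitz (jacobian f (at 0))"
    by (auto simp: Fst_def F0_def)
  obtain b a where bil: "bilinear b" and b: "\<And>x y. b x y = b y x" "\<And>x. (norm x)\<^sup>2 \<le> b x x"
    and "0 < a" and A: "\<And>x. b x (jacobian f (at 0) *v x) \<le> - a * b x x"
    using Hurwitz_quadratic_form[OF H] by metis
  obtain M where M: "M > 0" "\<And>x y. norm (b x y) \<le> M * norm x * norm y"
    using bilinear_bounded_pos[OF bil] by blast
  interpret lyapunov_form b M
    by unfold_locales (use bil b M in auto)
  have "f differentiable (at 0)"
    using f by (simp add: C1_on_def)
  then have "(f has_derivative (\<lambda>h. jacobian f (at 0) *v h)) (at 0)"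
    using jacobian_works by blast
  then have J: "blinfun_apply (Df f 0) = (\<lambda>h. jacobian f (at 0) *v h)"
    by (rule blinfun_apply_Df)
  have "isCont (Df f) 0"
    using f by (simp add: C1_on_def continuous_on_eq_continuous_at)
  then obtain s where "s > 0" and s: "\<And>x. dist x 0 < s \<Longrightarrow> dist (Df f x) (Df f 0) < a / (2 * M)"
    using \<open>0 < a\<close> M(1) unfolding continuous_at_eps_delta dist_norm
    by (metis divide_pos_pos mult_pos_pos zero_less_numeral)
  have Df_lin: "Df (blinfun_apply (Df f 0)) x = Df f 0" for x
    by (rule blinfun_eqI)
       (simp add: blinfun_apply_Df[OF bounded_linear_imp_has_derivative[OF blinfun.bounded_linear_right]])
  have "contracts_on a {x. b x x \<le> (s/2)\<^sup>2} (blinfun_apply (Df f 0))"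
    using A unfolding contracts_on_def Df_lin by (simp add: J)
  then have "contracts_on (a / 2) {x. b x x \<le> (s/2)\<^sup>2} f"
  proof (rule contracts_on_perturb[where e = "a / (2 * M)"])
    fix x assume "x \<in> {x. b x x \<le> (s/2)\<^sup>2}"
    then have "(norm x)\<^sup>2 \<le> (s/2)\<^sup>2" using lower[of x] by simp
    then have "norm x < s" using \<open>s > 0\<close> by (auto dest!: power2_le_imp_le)
    then show "norm (Df f x - Df (blinfun_apply (Df f 0)) x) \<le> a / (2 * M)"
      using s[of x] by (simp add: Df_lin dist_norm)
  qed (use \<open>0 < a\<close> M in auto)
  then show thesis
    using that[of b M "a / 2" "s / 2"] \<open>0 < a\<close> \<open>s > 0\<close> lyapunov_form_axioms by simp
qed

section \<open>Robust invariance of a tube around a trajectory\<close>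

lemma forward_curve_continuous_on:
  assumes "\<And>t. 0 \<le> t \<Longrightarrow> (y has_vector_derivative v t) (at t within {0..})" and "S \<subseteq> {0..}"
  shows "continuous_on S y"
proof -
  have "continuous_on {0..} y"
    by (rule continuous_on_vector_derivative) (use assms(1) in auto)
  then show ?thesis using assms(2) by (rule continuous_on_subset)
qed

lemma forward_curve_derivative_at:
  assumes "\<And>t. 0 \<le> t \<Longrightarrow> (y has_vector_derivative v t) (at t within {0..})" and "0 < t"
  shows "(y has_vector_derivative v t) (at (t::real))"
proof -
  have "at t within {0..} = at t"
    using assms(2) by (intro at_within_interior) simp
  with assms show ?thesis by (metis less_imp_le)
qed

text \<open>The decay of \<open>b x x\<close> is assumed only on the closed ellipsoid itself. Continuity of \<open>G\<close> gives the
inequality with an additional \<open>a * r\<^sup>2\<close> on a neighbourhood, which still drives \<open>b (y t) (y t)\<close> towards values at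
most \<open>r\<^sup>2\<close>; the curve is therefore trapped, and afterwards the sharp inequality applies.\<close>

lemma (in lyapunov_form) sublevel_decay:
  assumes contG: "continuous_on UNIV G" and "0 < a" "0 < r"
    and decr: "\<And>x. b x x \<le> r\<^sup>2 \<Longrightarrow> b x (G x) \<le> - a * b x x"
    and dy: "\<And>t. 0 \<le> t \<Longrightarrow> (y has_vector_derivative G (y t)) (at t within {0..})"
    and "0 \<le> t1" "t1 \<le> t" and start: "b (y t1) (y t1) \<le> r\<^sup>2"
  shows "b (y t) (y t) \<le> exp (- (2 * a) * (t - t1)) * r\<^sup>2" and "b (y t) (y t) \<le> r\<^sup>2"
proof -
  define S where "S s = b (y s) (y s)" for s
  have conty: "continuous_on {t1..s} y" for s
    using \<open>0 \<le> t1\<close> by (intro forward_curve_continuous_on[OF dy]) auto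
  have contS: "continuous_on {t1..s} S" for s
    unfolding S_def by (intro continuous_intros conty)
  have dS: "(S has_real_derivative 2 * b (y s) (G (y s))) (at s)" if "t1 < s" for s
    unfolding S_def using that \<open>0 \<le> t1\<close>
    by (intro has_real_derivative_diag forward_curve_derivative_at[OF dy]) auto
  define N where "N = {x. b x (G x) < - a * b x x + a * r\<^sup>2}"
  have "open N"
    unfolding N_def by (intro open_Collect_less continuous_intros contG)
  have inside: "y s \<in> {x. b x x \<le> r\<^sup>2}" if "s \<in> {t1..t}" for s
  proof (rule trapped_curve[OF conty \<open>open N\<close> _ _ that])
    show "{x. b x x \<le> r\<^sup>2} \<subseteq> N"
    proof
      fix x assume "x \<in> {x. b x x \<le> r\<^sup>2}"
      moreover have "0 < a * r\<^sup>2" using \<open>0 < a\<close> \<open>0 < r\<close> by simp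
      ultimately show "x \<in> N" using decr[of x] by (simp add: N_def)
    qed
  next
    fix s assume s: "t1 \<le> s" "s \<le> t" and N: "\<And>q. t1 \<le> q \<Longrightarrow> q < s \<Longrightarrow> y q \<in> N"
    have "2 * b (y q) (G (y q)) \<le> - (2 * a) * (S q - r\<^sup>2)" if "t1 < q" "q < s" for q
      using N[of q] that by (simp add: N_def S_def algebra_simps)
    then have "S s - r\<^sup>2 \<le> exp (- (2 * a) * (s - t1)) * (S t1 - r\<^sup>2)"
      by (intro gronwall_affine[OF s(1) contS dS])
    also have "\<dots> \<le> 0" using start by (simp add: S_def mult_le_0_iff)
    finally show "y s \<in> {x. b x x \<le> r\<^sup>2}" by (simp add: S_def)
  qed
  from inside[of t] \<open>t1 \<le> t\<close> show "b (y t) (y t) \<le> r\<^sup>2" by simp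
  have "2 * b (y q) (G (y q)) \<le> - (2 * a) * (S q - 0)" if "t1 < q" "q < t" for q
    using decr[of "y q"] inside[of q] that by (simp add: S_def)
  then have "S t - 0 \<le> exp (- (2 * a) * (t - t1)) * (S t1 - 0)"
    by (intro gronwall_affine[OF \<open>t1 \<le> t\<close> contS dS])
  also have "\<dots> \<le> exp (- (2 * a) * (t - t1)) * r\<^sup>2"
    using start by (simp add: S_def)
  finally show "b (y t) (y t) \<le> exp (- (2 * a) * (t - t1)) * r\<^sup>2" by (simp add: S_def)
qed

text \<open>The tube around the trajectory \<open>y0\<close> of \<open>p\<close> consists of the points \<open>x\<close> with
\<open>|x - y0 t|\<^sup>2 + \<delta>\<^sup>2 \<le> 2 * \<delta>\<^sup>2 * exp (c * t)\<close> for some \<open>t\<close> in \<open>[0, T]\<close>. By \<open>solutions_stay_close\<close> this inequality is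
transported along trajectories of every field that differs from \<open>f\<close> by at most \<open>\<delta>\<close>, and at \<open>t = 0\<close> it
describes the ball of radius \<open>\<delta>\<close> around \<open>p\<close>. The number \<open>\<delta>\<close> is so small that the end of the tube lies in the ellipsoid \<open>B\<close>.
Solutions of \<open>g\<close> are obtained from a cut-off field; as they turn out to remain in \<open>J\<close>, the cut-off does not matter.\<close>

lemma (in lyapunov_form) robust_tube:
  assumes f: "C1_on UNIV f" "f 0 = 0" and "0 < a" "0 < r"
    and B_def: "B = {x. b x x \<le> r\<^sup>2}"
    and contr: "contracts_on a B f" and p: "p \<in> DOA f"
  obtains J d T C where "compact J" "0 < d" "0 \<le> T" "0 < C" "ball p d \<subseteq> J" "B \<subseteq> J"
    and "\<And>g x. C1_on UNIV g \<Longrightarrow> g 0 = 0 \<Longrightarrow>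
        (\<And>x. x \<in> J \<Longrightarrow> norm (g x - f x) \<le> d \<and> norm (Df g x - Df f x) \<le> d) \<Longrightarrow> x \<in> J \<Longrightarrow>
        \<exists>y. y 0 = x \<and> forward_solution g y \<and> (\<forall>t\<ge>0. y t \<in> J) \<and> (\<forall>t\<ge>T. y t \<in> B) \<and>
          (\<forall>t\<ge>0. norm (y t) \<le> C * exp (- (a / 2) * t))"
proof -
  define y0 where "y0 t = flow f t p" for t
  have p': "\<And>t. 0 \<le> t \<Longrightarrow> flow_exists f t p" "(y0 \<longlongrightarrow> 0) at_top"
    using p by (auto simp: DOA_def y0_def[abs_def])
  have "y0 0 = p" "forward_solution f y0"
    using flow_forward_solution[OF f(1) p'(1)] by (auto simp: y0_def[abs_def])
  then have dy0: "(y0 has_vector_derivative f (y0 t)) (at t within {0..})" if "0 \<le> t" for t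
    using that by (simp add: forward_solution_def)
  have B_r: "B \<subseteq> cball 0 r"
  proof
    fix x assume "x \<in> B"
    then have "(norm x)\<^sup>2 \<le> r\<^sup>2" using lower[of x] by (simp add: B_def)
    then show "x \<in> cball 0 r" using \<open>0 < r\<close> by (auto dest: power2_le_imp_le)
  qed
  have B_convex: "convex B" and B_compact: "compact B"
    unfolding B_def by (rule sublevel_convex sublevel_compact)+
  have "0 \<in> B" using \<open>0 < r\<close> by (simp add: B_def)
  define d1 where "d1 = r / (2 * sqrt M)"
  have "d1 > 0" using \<open>0 < r\<close> M_pos by (simp add: d1_def)
  have d1: "cball 0 (2 * d1) \<subseteq> B"
  proof
    fix x :: 'a assume "x \<in> cball 0 (2 * d1)"
    then have "M * (norm x)\<^sup>2 \<le> M * (2 * d1)\<^sup>2"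
      using M_pos by (intro mult_left_mono power_mono) auto
    also have "\<dots> = r\<^sup>2" using M_pos by (simp add: d1_def power_divide power_mult_distrib)
    finally show "x \<in> B" using diag_upper[of x] by (simp add: B_def)
  qed
  have "eventually (\<lambda>t. 0 \<le> t \<and> dist (y0 t) 0 < d1) at_top"
    by (intro eventually_conj eventually_ge_at_top tendstoD[OF p'(2)] \<open>d1 > 0\<close>)
  then obtain T where "0 \<le> T" and T: "norm (y0 T) < d1"
    by (auto dest!: eventually_happens)
  have conty0: "continuous_on {0..T} y0"
    by (rule forward_curve_continuous_on[OF dy0]) auto
  then have "bounded (y0 ` {0..T})"
    by (intro compact_imp_bounded compact_continuous_image) auto
  then obtain R0 where "R0 > 0" and R0: "\<And>t. 0 \<le> t \<Longrightarrow> t \<le> T \<Longrightarrow> norm (y0 t) \<le> R0"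
    unfolding bounded_pos by force
  define R where "R = R0 + r + 2"
  obtain L where "L \<ge> 0"
    and L: "\<And>x y. x \<in> cball 0 R \<Longrightarrow> y \<in> cball 0 R \<Longrightarrow> norm (f x - f y) \<le> L * norm (x - y)"
    using C1_Lipschitz_on_cball[OF f(1)] by metis
  define c where "c = 2 * L + 1"
  have "c > 0" using \<open>L \<ge> 0\<close> by (simp add: c_def)
  define m where "m = min 1 d1"
  have "m > 0" using \<open>d1 > 0\<close> by (simp add: m_def)
  define \<delta> where "\<delta> = m / (2 * exp (c * T))"
  have "\<delta> > 0" using \<open>m > 0\<close> by (simp add: \<delta>_def)
  define near where "near t x \<longleftrightarrow> (norm (x - y0 t))\<^sup>2 + \<delta>\<^sup>2 \<le> 2 * \<delta>\<^sup>2 * exp (c * t)" for t x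
  define tube where "tube = {x. \<exists>t\<in>{0..T}. near t x}"
  have near_m: "norm (x - y0 t) \<le> m" if "near t x" "t \<le> T" for t x
  proof -
    have "(norm (x - y0 t))\<^sup>2 \<le> 2 * \<delta>\<^sup>2 * exp (c * t)"
      using that by (simp add: near_def) (metis add_increasing2 dual_order.trans le_add_same_cancel1 zero_le_power2)
    also have "\<dots> \<le> 2 * \<delta>\<^sup>2 * exp (c * T)"
      using that \<open>c > 0\<close> by (intro mult_left_mono) auto
    also have "\<dots> = m\<^sup>2 / (2 * exp (c * T))"
      by (simp add: \<delta>_def power2_eq_square)
    also have "\<dots> \<le> m\<^sup>2 / 1"
    proof (rule divide_left_mono)
      have "1 \<le> exp (c * T)" using \<open>c > 0\<close> \<open>0 \<le> T\<close> by simp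
      then show "1 \<le> 2 * exp (c * T)" by linarith
    qed auto
    finally show ?thesis using \<open>m > 0\<close> by (auto dest: power2_le_imp_le)
  qed
  define rad where "rad t = sqrt (2 * \<delta>\<^sup>2 * exp (c * t) - \<delta>\<^sup>2)" for t
  have rad_pos: "2 * \<delta>\<^sup>2 * exp (c * t) - \<delta>\<^sup>2 > 0" if "0 \<le> t" for t
  proof -
    have "1 \<le> exp (c * t)" using \<open>c > 0\<close> that by simp
    then have "\<delta>\<^sup>2 * 1 \<le> \<delta>\<^sup>2 * exp (c * t)" by (intro mult_left_mono) auto
    moreover have "\<delta>\<^sup>2 > 0" using \<open>\<delta> > 0\<close> by simp
    ultimately show ?thesis by linarith
  qed
  have near_rad: "near t x \<longleftrightarrow> norm (x - y0 t) \<le> rad t" if "0 \<le> t" for t x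
  proof -
    have "(rad t)\<^sup>2 = 2 * \<delta>\<^sup>2 * exp (c * t) - \<delta>\<^sup>2" "0 \<le> rad t"
      using rad_pos[OF that] by (simp_all add: rad_def)
    then show ?thesis
      using abs_le_square_iff[of "norm (x - y0 t)" "rad t"] by (auto simp: near_def)
  qed
  have "tube = (\<lambda>(t, v). y0 t + rad t *\<^sub>R v) ` ({0..T} \<times> cball 0 1)"
  proof (intro equalityI subsetI)
    fix x assume "x \<in> tube"
    then obtain t where t: "t \<in> {0..T}" "norm (x - y0 t) \<le> rad t"
      by (auto simp: tube_def near_rad)
    have "rad t > 0" using rad_pos t by (simp add: rad_def)
    then show "x \<in> (\<lambda>(t, v). y0 t + rad t *\<^sub>R v) ` ({0..T} \<times> cball 0 1)"
      using t by (intro image_eqI[of _ _ "(t, (1 / rad t) *\<^sub>R (x - y0 t))"]) (auto simp: divide_simps)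
  next
    fix x assume "x \<in> (\<lambda>(t, v). y0 t + rad t *\<^sub>R v) ` ({0..T} \<times> cball 0 1)"
    then obtain t v where t: "t \<in> {0..T}" "norm v \<le> 1" "x = y0 t + rad t *\<^sub>R v"
      by auto
    have "rad t > 0" using rad_pos t by (simp add: rad_def)
    then have "norm (x - y0 t) \<le> rad t" using t by (simp add: mult_left_le)
    then have "near t x" using t(1) by (simp add: near_rad)
    then show "x \<in> tube" using t(1) by (auto simp: tube_def)
  qed
  moreover have "continuous_on ({0..T} \<times> cball 0 1) (\<lambda>(t, v). y0 t + rad t *\<^sub>R v)"
    unfolding case_prod_beta rad_def
    by (intro continuous_intros continuous_on_compose2[OF conty0]) auto
  ultimately have tube_compact: "compact tube"
    by (simp add: compact_continuous_image compact_Times)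
  define J where "J = B \<union> tube"
  define d where "d = min (\<delta> / 2) (a / (2 * M))"
  have "d > 0" and d: "d < \<delta>" "M * d \<le> a / 2"
    using \<open>\<delta> > 0\<close> \<open>0 < a\<close> M_pos by (auto simp: d_def min_def field_simps)
  have J_ball: "x \<in> ball 0 R" if "x \<in> J" for x
    using that unfolding J_def
  proof
    assume "x \<in> B"
    then show ?thesis using B_r \<open>R0 > 0\<close> by (auto simp: R_def)
  next
    assume "x \<in> tube"
    then obtain t where t: "0 \<le> t" "t \<le> T" "near t x" by (auto simp: tube_def)
    have "norm x \<le> norm (x - y0 t) + norm (y0 t)" by (metis diff_add_cancel norm_triangle_ineq)
    also have "\<dots> \<le> 1 + R0"
      using near_m[OF t(3,2)] R0[OF t(1,2)] by (simp add: m_def)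
    finally show ?thesis using \<open>0 < r\<close> by (simp add: R_def)
  qed
  define C where "C = R * exp (a / 2 * T)"
  have "C > 0" using \<open>R0 > 0\<close> \<open>0 < r\<close> by (simp add: C_def R_def)
  show thesis
  proof
    show "compact J" unfolding J_def by (intro compact_Un B_compact tube_compact)
    show "ball p d \<subseteq> J"
    proof
      fix x assume "x \<in> ball p d"
      then have "norm (x - y0 0) \<le> \<delta>"
        using d by (simp add: \<open>y0 0 = p\<close> dist_norm norm_minus_commute)
      then have "(norm (x - y0 0))\<^sup>2 \<le> \<delta>\<^sup>2"
        by (intro power_mono) auto
      then have "near 0 x" by (simp add: near_def)
      then show "x \<in> J" using \<open>0 \<le> T\<close> by (auto simp: J_def tube_def)
    qed
    show "B \<subseteq> J" by (simp add: J_def)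
  next
    fix g x
    assume g: "C1_on UNIV g" "g 0 = 0" and x: "x \<in> J"
      and close: "\<And>x. x \<in> J \<Longrightarrow> norm (g x - f x) \<le> d \<and> norm (Df g x - Df f x) \<le> d"
    have "0 \<le> R" using \<open>R0 > 0\<close> \<open>0 < r\<close> by (simp add: R_def)
    define G where "G z = g (closest_point (cball 0 R) z)" for z
    have G: "G z = g z" if "z \<in> ball 0 R" for z
      using that by (simp add: G_def closest_point_self)
    have contG: "continuous_on UNIV G"
      unfolding G_def using \<open>0 \<le> R\<close>
      by (intro continuous_on_compose2[OF C1_continuous_on[OF g(1), of UNIV]] continuous_on_closest_point) auto
    obtain y where y: "y 0 = x"
      and dy: "\<And>t. 0 \<le> t \<Longrightarrow> (y has_vector_derivative G (y t)) (at t within {0..})"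
      using cutoff_global_solution[OF g(1) \<open>0 \<le> R\<close>, of x] unfolding G_def by metis
    have gcontr: "contracts_on (a / 2) B g"
    proof (rule contracts_on_perturb[OF contr, where e = d])
      show "norm (Df g x - Df f x) \<le> d" if "x \<in> B" for x
        using close[of x] that by (auto simp: J_def)
    qed (use d \<open>0 < a\<close> in auto)
    have Gdecr: "b x (G x) \<le> - (a / 2) * b x x" if "b x x \<le> r\<^sup>2" for x
    proof -
      have "x \<in> B" using that by (simp add: B_def)
      then have "b (x - 0) (g x - g 0) \<le> - (a / 2) * b (x - 0) (x - 0)"
        by (intro contracts_on_increment[OF gcontr g(1) B_convex \<open>0 \<in> B\<close>])
      then show ?thesis
        using G[OF J_ball[of x]] \<open>x \<in> B\<close> by (simp add: g(2) J_def)
    qed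
    have "0 < a / 2" using \<open>0 < a\<close> by simp
    note decay = sublevel_decay[OF contG this \<open>0 < r\<close> Gdecr dy]
    \<comment> \<open>On \<open>J\<close> the fields differ by at most \<open>d < \<delta>\<close>; this gap gives an open neighbourhood of \<open>J\<close> on which
      they differ by less than \<open>\<delta>\<close>, as \<open>trapped_curve\<close> requires.\<close>
    define N where "N = ball 0 R \<inter> {z. norm (g z - f z) < \<delta>}"
    have "open N"
      unfolding N_def
      by (intro open_Int open_ball open_Collect_less continuous_intros
          C1_continuous_on[OF g(1)] C1_continuous_on[OF f(1)])
    have "J \<subseteq> N"
      using J_ball close d(1) by (fastforce simp: N_def)
    have "\<exists>t1. 0 \<le> t1 \<and> t1 \<le> T \<and> (\<forall>t. 0 \<le> t \<longrightarrow> t \<le> t1 \<longrightarrow> y t \<in> J) \<and> y t1 \<in> B"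
    proof (cases "x \<in> B")
      case True
      then show ?thesis using y \<open>0 \<le> T\<close> by (intro exI[of _ 0]) (auto simp: J_def order_antisym)
    next
      case False
      with x obtain q where q: "0 \<le> q" "q \<le> T" "near q x"
        by (auto simp: J_def tube_def)
      have conty: "continuous_on {0..s} y" for s
        by (rule forward_curve_continuous_on[OF dy]) auto
      have follow: "near (q + s) (y s)"
        if s: "0 \<le> s" "s \<le> T - q" and N: "\<And>t. 0 \<le> t \<Longrightarrow> t < s \<Longrightarrow> y t \<in> N" for s
      proof -
        have "(norm (y s - y0 (q + s)))\<^sup>2 + \<delta>\<^sup>2
            \<le> exp ((2 * L + 1) * (s - 0)) * ((norm (y 0 - y0 (q + 0)))\<^sup>2 + \<delta>\<^sup>2)"
        proof (rule solutions_stay_close[where v = "\<lambda>t. G (y t)" and w = "\<lambda>t. f (y0 (q + t))",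
              OF s(1) conty])
          show "continuous_on {0..s} (\<lambda>t. y0 (q + t))"
            by (intro continuous_on_compose2[OF conty0] continuous_intros) (use q s in auto)
        next
          fix t assume t: "0 < t" "t < s"
          show "(y has_vector_derivative G (y t)) (at t)"
            using forward_curve_derivative_at[OF dy t(1)] .
          have "(y0 has_vector_derivative f (y0 (q + t))) (at (q + t))"
            using q t by (intro forward_curve_derivative_at[OF dy0]) auto
          moreover have "((\<lambda>t. q + t) has_vector_derivative 1) (at t)"
            by (auto intro!: derivative_eq_intros)
          ultimately show "((\<lambda>t. y0 (q + t)) has_vector_derivative f (y0 (q + t))) (at t)"
            using vector_diff_chain_at[of "\<lambda>t. q + t" 1 t y0] by (simp add: o_def)
          have "y t \<in> N" using N t by simp
          then have *: "y t \<in> ball 0 R" "norm (g (y t) - f (y t)) \<le> \<delta>" by (auto simp: N_def)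
          have "norm (y0 (q + t)) \<le> R0" using q s t by (intro R0) auto
          then have "norm (f (y t) - f (y0 (q + t))) \<le> L * norm (y t - y0 (q + t))"
            using *(1) \<open>0 < r\<close> by (intro L) (auto simp: R_def)
          then show "norm (G (y t) - f (y0 (q + t))) \<le> L * norm (y t - y0 (q + t)) + \<delta>"
            unfolding G[OF *(1)]
            using *(2) norm_triangle_ineq[of "g (y t) - f (y t)" "f (y t) - f (y0 (q + t))"] by simp
        qed (use \<open>L \<ge> 0\<close> in auto)
        also have "\<dots> \<le> exp (c * s) * (2 * \<delta>\<^sup>2 * exp (c * q))"
          using q(3) by (simp add: near_def y c_def)
        also have "\<dots> = 2 * \<delta>\<^sup>2 * exp (c * (q + s))"
          by (simp add: distrib_left exp_add)
        finally show ?thesis by (simp add: near_def)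
      qed
      have in_tube: "y s \<in> tube" if "0 \<le> s" "s \<le> T - q" "near (q + s) (y s)" for s
        using that q by (auto simp: tube_def intro!: bexI[of _ "q + s"])
      have inJ: "y t \<in> J" if "t \<in> {0..T - q}" for t
        using trapped_curve[OF conty \<open>open N\<close> \<open>J \<subseteq> N\<close> _ that] follow in_tube
        unfolding J_def by blast
      then have "near (q + (T - q)) (y (T - q))"
        using q \<open>J \<subseteq> N\<close> by (intro follow) auto
      then have "norm (y (T - q) - y0 T) \<le> d1"
        using near_m[of T "y (T - q)"] by (simp add: m_def)
      then have "norm (y (T - q)) \<le> 2 * d1"
        using T norm_triangle_ineq[of "y (T - q) - y0 T" "y0 T"] by simp
      then have "y (T - q) \<in> B" using d1 by auto
      then show ?thesis using inJ q by (intro exI[of _ "T - q"]) auto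
    qed
    then obtain t1 where t1: "0 \<le> t1" "t1 \<le> T" "\<And>t. 0 \<le> t \<Longrightarrow> t \<le> t1 \<Longrightarrow> y t \<in> J" "y t1 \<in> B"
      by blast
    have later: "y t \<in> B" "(norm (y t))\<^sup>2 \<le> (r * exp (- (a / 2) * (t - t1)))\<^sup>2" if "t1 \<le> t" for t
    proof -
      show "y t \<in> B"
        using decay(2)[OF _ _ t1(1) that] t1(4) by (simp add: B_def)
      have "(norm (y t))\<^sup>2 \<le> exp (- (2 * (a / 2)) * (t - t1)) * r\<^sup>2"
        using decay(1)[OF _ _ t1(1) that] t1(4) lower[of "y t"] by (simp add: B_def)
      also have "\<dots> = (r * exp (- (a / 2) * (t - t1)))\<^sup>2"
        by (simp add: power_mult_distrib exp_double[symmetric] field_simps)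
      finally show "(norm (y t))\<^sup>2 \<le> (r * exp (- (a / 2) * (t - t1)))\<^sup>2" .
    qed
    have inJ: "y t \<in> J" if "0 \<le> t" for t
      using t1(3)[OF that] later(1)[of t] by (cases "t \<le> t1") (auto simp: J_def)
    have sol: "forward_solution g y"
      unfolding forward_solution_def using dy inJ G J_ball by fastforce
    have bound: "norm (y t) \<le> C * exp (- (a / 2) * t)" if "0 \<le> t" for t
    proof -
      have "norm (y t) \<le> R * exp (- (a / 2) * (t - T))"
      proof (cases "t \<le> t1")
        case True
        have "norm (y t) \<le> R * 1" using J_ball[OF inJ[OF that]] by simp
        also have "\<dots> \<le> R * exp (- (a / 2) * (t - T))"
          using True t1 \<open>0 < a\<close> \<open>0 \<le> R\<close> by (intro mult_left_mono) (auto simp: mult_le_0_iff)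
        finally show ?thesis .
      next
        case False
        then have "norm (y t) \<le> r * exp (- (a / 2) * (t - t1))"
          using later(2)[of t] \<open>0 < r\<close> by (auto dest: power2_le_imp_le)
        also have "\<dots> \<le> R * exp (- (a / 2) * (t - T))"
          using \<open>0 < r\<close> \<open>R0 > 0\<close> \<open>0 < a\<close> t1 by (intro mult_mono) (auto simp: R_def)
        finally show ?thesis .
      qed
      also have "\<dots> = C * exp (- (a / 2) * t)"
        by (simp add: C_def field_simps flip: exp_add)
      finally show ?thesis .
    qed
    show "\<exists>y. y 0 = x \<and> forward_solution g y \<and> (\<forall>t\<ge>0. y t \<in> J) \<and> (\<forall>t\<ge>T. y t \<in> B) \<and>
          (\<forall>t\<ge>0. norm (y t) \<le> C * exp (- (a / 2) * t))"
      using y sol inJ bound later(1) t1(2) by (intro exI[of _ y]) auto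
  qed fact+
qed

section \<open>Decay of perturbed linearized solutions\<close>

text \<open>Here \<open>m\<close> is a main term that is at most proportional to \<open>w\<close> and that contracts from time \<open>T\<close> on, and \<open>n\<close> is an
exponentially decaying perturbation. The squared size \<open>S\<close> satisfies \<open>S' \<le> - a * S + D * exp (- (a / 2) * t)\<close> after time \<open>T\<close>, so
\<open>R t = exp (a / 2 * t) * S t\<close> satisfies an affine inequality in both phases. The rate \<open>a / 4\<close> of
the perturbation and of the conclusion agree, so that the result of one application can serve as the perturbation in the next.\<close>

lemma (in lyapunov_form) exponential_estimate:
  assumes "0 < a" "0 \<le> T" "0 \<le> L"
  obtains C where "C > 0"
    and "\<And>w m n \<kappa> t. (\<And>t. 0 \<le> t \<Longrightarrow> (w has_vector_derivative m t + n t) (at t within {0..})) \<Longrightarrow>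
      (\<And>t. 0 \<le> t \<Longrightarrow> norm (m t) \<le> L * norm (w t)) \<Longrightarrow>
      (\<And>t. T \<le> t \<Longrightarrow> b (w t) (m t) \<le> - a * b (w t) (w t)) \<Longrightarrow>
      0 \<le> \<kappa> \<Longrightarrow> (\<And>t. 0 \<le> t \<Longrightarrow> norm (n t) \<le> \<kappa> * exp (- (a / 4) * t)) \<Longrightarrow> 0 \<le> t \<Longrightarrow>
      norm (w t) \<le> C * (norm (w 0) + \<kappa>) * exp (- (a / 4) * t)"
proof -
  define c where "c = 2 * M * L + 3 * a / 2"
  have "c \<ge> a / 2" "c > 0" using assms M_pos by (auto simp: c_def intro: add_nonneg_pos)
  define E where "E = exp (c * T)"
  have "E \<ge> 1" using \<open>c > 0\<close> \<open>0 \<le> T\<close> by (simp add: E_def)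
  define K where "K = M + 2 * M\<^sup>2 / a\<^sup>2"
  have "K > 0" using M_pos \<open>0 < a\<close> by (simp add: K_def add_pos_nonneg)
  define C where "C = sqrt (2 * E * K)"
  have "C > 0" using \<open>E \<ge> 1\<close> \<open>K > 0\<close> by (simp add: C_def)
  show thesis
  proof (rule that[OF \<open>C > 0\<close>])
    fix w m n :: "real \<Rightarrow> 'a" and \<kappa> t :: real
    assume dw: "\<And>t. 0 \<le> t \<Longrightarrow> (w has_vector_derivative m t + n t) (at t within {0..})"
      and mL: "\<And>t. 0 \<le> t \<Longrightarrow> norm (m t) \<le> L * norm (w t)"
      and mb: "\<And>t. T \<le> t \<Longrightarrow> b (w t) (m t) \<le> - a * b (w t) (w t)"
      and "0 \<le> \<kappa>" and n: "\<And>t. 0 \<le> t \<Longrightarrow> norm (n t) \<le> \<kappa> * exp (- (a / 4) * t)" and "0 \<le> t"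
    define S where "S t = b (w t) (w t)" for t
    define R where "R t = exp (a / 2 * t) * S t" for t
    define D where "D = M\<^sup>2 / a * \<kappa>\<^sup>2"
    have "D \<ge> 0" using \<open>0 < a\<close> by (simp add: D_def)
    define R' where "R' t = a / 2 * R t + exp (a / 2 * t) * (2 * b (w t) (m t + n t))" for t
    have Rnn: "0 \<le> R t" for t by (simp add: R_def S_def diag_nonneg)
    have contR: "continuous_on S R" if "S \<subseteq> {0..}" for S
      unfolding R_def S_def
      by (intro continuous_intros forward_curve_continuous_on[OF dw that])
    have dR: "(R has_real_derivative R' t) (at t)" if "0 < t" for t
    proof -
      have "(S has_real_derivative 2 * b (w t) (m t + n t)) (at t)"
        unfolding S_def by (intro has_real_derivative_diag forward_curve_derivative_at[OF dw that])
      then show ?thesis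
        unfolding R_def R'_def by (auto intro!: derivative_eq_intros)
    qed
    have R'_le: "R' t \<le> 3 * a / 2 * R t + D + exp (a / 2 * t) * (2 * b (w t) (m t))" if "0 \<le> t" for t
    proof -
      have "2 * b (w t) (n t) \<le> 2 * (M * norm (w t) * norm (n t))"
        using upper[of "w t" "n t"] by simp
      also have "\<dots> \<le> a * (norm (w t))\<^sup>2 + M\<^sup>2 / a * (norm (n t))\<^sup>2"
      proof -
        have "0 \<le> (a * norm (w t) - M * norm (n t))\<^sup>2 / a" using \<open>0 < a\<close> by simp
        then show ?thesis using \<open>0 < a\<close> by (simp add: power2_eq_square field_simps)
      qed
      also have "\<dots> \<le> a * S t + M\<^sup>2 / a * (\<kappa> * exp (- (a / 4) * t))\<^sup>2"
        using \<open>0 < a\<close> lower[of "w t"] n[OF that] unfolding S_def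
        by (intro add_mono mult_left_mono power_mono) auto
      also have "(\<kappa> * exp (- (a / 4) * t))\<^sup>2 = \<kappa>\<^sup>2 * exp (- (a / 2) * t)"
        by (simp add: power_mult_distrib exp_double[symmetric])
      finally have "exp (a / 2 * t) * (2 * b (w t) (n t))
          \<le> exp (a / 2 * t) * (a * S t + D * exp (- (a / 2) * t))"
        by (simp add: D_def)
      also have "\<dots> = a * R t + D"
        by (simp add: R_def distrib_left exp_minus)
      finally show ?thesis
        by (simp add: R'_def bilinear_radd[OF bilinear] distrib_left)
    qed
    have early: "R q \<le> E * (R 0 + 2 * D / a)" if q: "0 \<le> q" "q \<le> T" for q
    proof -
      have "R' s \<le> c * (R s - (- (D / c)))" if "0 < s" "s < q" for s
      proof -
        have "b (w s) (m s) \<le> M * norm (w s) * norm (m s)" using upper by (meson abs_le_D1)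
        also have "\<dots> \<le> M * norm (w s) * (L * norm (w s))"
          using M_pos mL[of s] that by (intro mult_left_mono) auto
        also have "\<dots> = M * L * (norm (w s))\<^sup>2" by (simp add: power2_eq_square)
        also have "\<dots> \<le> M * L * S s"
          unfolding S_def using M_pos \<open>0 \<le> L\<close> lower by (intro mult_left_mono) auto
        finally have "exp (a / 2 * s) * (2 * b (w s) (m s)) \<le> exp (a / 2 * s) * (2 * (M * L * S s))"
          by simp
        also have "\<dots> = 2 * M * L * R s" by (simp add: R_def)
        finally have "R' s \<le> c * R s + D"
          using R'_le[of s] that by (simp add: c_def distrib_right)
        then show ?thesis
          using \<open>c > 0\<close> by (simp add: distrib_left)
      qed
      then have "R q - (- (D / c)) \<le> exp (c * (q - 0)) * (R 0 - (- (D / c)))"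
        by (intro gronwall_affine[where S' = R'] q contR dR) auto
      also have "\<dots> \<le> E * (R 0 + 2 * D / a)"
        unfolding E_def
      proof (rule mult_mono)
        have "D / c \<le> D / (a / 2)"
          using \<open>c \<ge> a / 2\<close> \<open>0 < a\<close> \<open>D \<ge> 0\<close> by (intro divide_left_mono) auto
        then show "R 0 - (- (D / c)) \<le> R 0 + 2 * D / a" by (simp add: mult.commute)
      qed (use q \<open>c > 0\<close> \<open>D \<ge> 0\<close> Rnn[of 0] in auto)
      finally show ?thesis using \<open>D \<ge> 0\<close> \<open>c > 0\<close> by (smt (verit) divide_nonneg_pos)
    qed
    have late: "R q \<le> R T + 2 * D / a" if q: "T \<le> q" for q
    proof -
      have "R' s \<le> - (a / 2) * (R s - 2 * D / a)" if s: "T < s" "s < q" for s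
      proof -
        have "exp (a / 2 * s) * (2 * b (w s) (m s)) \<le> exp (a / 2 * s) * (2 * (- a * S s))"
          using mb[of s] s unfolding S_def by (intro mult_left_mono) auto
        also have "\<dots> = - 2 * a * R s" by (simp add: R_def)
        finally have "exp (a / 2 * s) * (2 * b (w s) (m s)) \<le> - 2 * a * R s" .
        moreover have "R' s \<le> 3 * a / 2 * R s + D + exp (a / 2 * s) * (2 * b (w s) (m s))"
          using s \<open>0 \<le> T\<close> by (intro R'_le) simp
        ultimately have "R' s \<le> 3 * a / 2 * R s + D + - 2 * a * R s" by linarith
        also have "\<dots> = - (a / 2) * (R s - 2 * D / a)"
          using \<open>0 < a\<close> by (simp add: field_simps)
        finally show ?thesis .
      qed
      then have "R q - 2 * D / a \<le> exp (- (a / 2) * (q - T)) * (R T - 2 * D / a)"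
        using \<open>0 \<le> T\<close> by (intro gronwall_affine[where S' = R'] q contR dR) auto
      also have "\<dots> \<le> exp (- (a / 2) * (q - T)) * R T"
        using \<open>D \<ge> 0\<close> \<open>0 < a\<close> by (intro mult_left_mono) auto
      also have "\<dots> \<le> 1 * R T"
        using q \<open>0 < a\<close> Rnn by (intro mult_right_mono) auto
      finally show ?thesis by simp
    qed
    have D': "0 \<le> 2 * D / a" using \<open>D \<ge> 0\<close> \<open>0 < a\<close> by simp
    have E1: "2 * D / a \<le> E * (R 0 + 2 * D / a)"
      using mult_mono[of 1 E "2 * D / a" "R 0 + 2 * D / a"] \<open>E \<ge> 1\<close> D' Rnn[of 0] by simp
    have "R t \<le> E * (R 0 + 2 * D / a) + E * (R 0 + 2 * D / a)"
    proof (cases "t \<le> T")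
      case True
      show ?thesis
        using add_mono[OF early[OF \<open>0 \<le> t\<close> True] order_trans[OF D' E1]] by simp
    next
      case False
      have "R t \<le> R T + 2 * D / a" using late False by simp
      also have "\<dots> \<le> E * (R 0 + 2 * D / a) + E * (R 0 + 2 * D / a)"
        by (intro add_mono early \<open>0 \<le> T\<close> order_refl E1)
      finally show ?thesis .
    qed
    also have "\<dots> = 2 * (E * (R 0 + 2 * D / a))" by simp
    also have "R 0 + 2 * D / a \<le> K * (norm (w 0) + \<kappa>)\<^sup>2"
    proof -
      have "R 0 \<le> M * (norm (w 0))\<^sup>2" by (simp add: R_def S_def diag_upper)
      also have "M * (norm (w 0))\<^sup>2 \<le> M * (norm (w 0) + \<kappa>)\<^sup>2"
        using M_pos \<open>0 \<le> \<kappa>\<close> by (intro mult_left_mono power_mono) auto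
      finally have 1: "R 0 \<le> M * (norm (w 0) + \<kappa>)\<^sup>2" .
      have "2 * D / a = 2 * M\<^sup>2 / a\<^sup>2 * \<kappa>\<^sup>2"
        using \<open>0 < a\<close> by (simp add: D_def power2_eq_square)
      also have "\<dots> \<le> 2 * M\<^sup>2 / a\<^sup>2 * (norm (w 0) + \<kappa>)\<^sup>2"
        using \<open>0 \<le> \<kappa>\<close> by (intro mult_left_mono power_mono) auto
      finally show ?thesis using 1 by (simp add: K_def distrib_right)
    qed
    finally have "R t \<le> 2 * (E * (K * (norm (w 0) + \<kappa>)\<^sup>2))"
      using \<open>E \<ge> 1\<close> by simp
    then have R_le: "R t \<le> C\<^sup>2 * (norm (w 0) + \<kappa>)\<^sup>2"
      using \<open>E \<ge> 1\<close> \<open>K > 0\<close> by (simp add: C_def)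
    have "(norm (w t))\<^sup>2 \<le> exp (- (a / 2) * t) * R t"
      using lower[of "w t"] by (simp add: R_def S_def mult.assoc[symmetric] flip: exp_add)
    also have "\<dots> \<le> exp (- (a / 2) * t) * (C\<^sup>2 * (norm (w 0) + \<kappa>)\<^sup>2)"
      using R_le by simp
    also have "\<dots> = (C * (norm (w 0) + \<kappa>) * exp (- (a / 4) * t))\<^sup>2"
      by (simp add: power_mult_distrib exp_double[symmetric])
    finally have "(norm (w t))\<^sup>2 \<le> (C * (norm (w 0) + \<kappa>) * exp (- (a / 4) * t))\<^sup>2" .
    then show "norm (w t) \<le> C * (norm (w 0) + \<kappa>) * exp (- (a / 4) * t)"
      using \<open>C > 0\<close> \<open>0 \<le> \<kappa>\<close> by (auto dest: power2_le_imp_le)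
  qed
qed

lemma exponentially_bounded_integral:
  fixes q :: "real \<Rightarrow> real"
  assumes "continuous_on {0..} q" and bound: "\<And>t. 0 \<le> t \<Longrightarrow> \<bar>q t\<bar> \<le> K * exp (- \<gamma> * t)" and "0 < \<gamma>"
  shows "q integrable_on {0..}" and "\<bar>integral {0..} q\<bar> \<le> K / \<gamma>"
proof -
  have e: "((\<lambda>t. K * exp (- \<gamma> * t)) has_integral K * (exp (- \<gamma> * 0) / \<gamma>)) {0..}"
    by (intro has_integral_mult_right has_integral_exp_minus_to_infinity \<open>0 < \<gamma>\<close>)
  show int: "q integrable_on {0..}"
  proof (rule measurable_bounded_by_integrable_imp_integrable)
    show "q \<in> borel_measurable (lebesgue_on {0..})"
      by (intro continuous_imp_measurable_on_sets_lebesgue assms) auto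
  qed (use e bound in \<open>auto simp: integrable_on_def\<close>)
  have "norm (integral {0..} q) \<le> integral {0..} (\<lambda>t. K * exp (- \<gamma> * t))"
    using e bound by (intro integral_norm_bound_integral int) (auto simp: integrable_on_def)
  also have "\<dots> = K / \<gamma>" using integral_unique[OF e] by simp
  finally show "\<bar>integral {0..} q\<bar> \<le> K / \<gamma>" by simp
qed

lemma C1_linearization:
  fixes f :: "'a::euclidean_space \<Rightarrow> 'b::real_normed_vector"
  assumes f: "C1_on UNIV f" and x: "x \<in> cball 0 R" and y: "y \<in> cball 0 R"
    and close: "\<And>z. z \<in> cball 0 R \<Longrightarrow> norm (z - x) \<le> norm (y - x) \<Longrightarrow> norm (Df f z - Df f x) \<le> e"
  shows "norm (f y - f x - Df f x (y - x)) \<le> e * norm (y - x)"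
proof -
  have "norm (f y - f x - Df f x (y - x)) \<le> norm (y - x) * e"
  proof (rule differentiable_bound_linearization[of x y "closed_segment x y" f
        "\<lambda>z. blinfun_apply (Df f z)" x e])
    fix t :: real assume "t \<in> {0..1}"
    then show "x + t *\<^sub>R (y - x) \<in> closed_segment x y"
      unfolding in_segment by (intro exI[of _ t]) (simp add: algebra_simps)
  next
    fix z assume z: "z \<in> closed_segment x y"
    show "(f has_derivative blinfun_apply (Df f z)) (at z within closed_segment x y)"
      by (rule has_derivative_at_withinI[OF C1_has_derivative[OF f]])
    have "z \<in> cball 0 R"
      using closed_segment_subset[OF x y convex_cball] z by blast
    then have *: "norm (Df f z - Df f x) \<le> e"
      using segment_bound1[OF z] by (intro close) (auto simp: norm_minus_commute)
    have "blinfun_apply (Df f z) - blinfun_apply (Df f x) = blinfun_apply (Df f z - Df f x)"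
      by (rule ext) (simp add: blinfun.diff_left)
    with * show "onorm (blinfun_apply (Df f z) - blinfun_apply (Df f x)) \<le> e"
      by (simp add: norm_blinfun.rep_eq)
  qed simp
  then show ?thesis by (simp add: mult.commute)
qed

lemma C1_modulus:
  fixes f :: "'a::euclidean_space \<Rightarrow> 'b::real_normed_vector"
  assumes f: "C1_on UNIV f" and "0 < e"
  obtains d where "0 < d"
    and "\<And>x y. x \<in> cball 0 R \<Longrightarrow> y \<in> cball 0 R \<Longrightarrow> norm (y - x) < d \<Longrightarrow> norm (Df f y - Df f x) \<le> e"
proof -
  have "uniformly_continuous_on (cball 0 R) (Df f)"
    by (intro compact_uniformly_continuous C1_continuous_on_Df f compact_cball)
  then show thesis
    using that \<open>0 < e\<close> unfolding uniformly_continuous_on_def dist_norm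
    by (metis less_imp_le)
qed

lemma variational_solution:
  fixes f :: "'a::euclidean_space \<Rightarrow> 'a"
  assumes f: "C1_on UNIV f" and y: "continuous_on {0..} y"
    and yR: "\<And>t. 0 \<le> t \<Longrightarrow> norm (Df f (y t)) \<le> L"
  shows "\<exists>X. X 0 = id_blinfun \<and>
    (\<forall>t\<ge>0. (X has_vector_derivative Df f (y t) o\<^sub>L X t) (at t within {0..}))"
proof (rule global_solution_Lipschitz[of "\<lambda>t Y. Df f (y t) o\<^sub>L Y" L 0 "id_blinfun :: 'a \<Rightarrow>\<^sub>L 'a"])
  fix z :: "real \<Rightarrow> 'a \<Rightarrow>\<^sub>L 'a" assume z: "continuous_on {0..} z"
  show "continuous_on {0..} (\<lambda>t. Df f (y t) o\<^sub>L z t)"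
    by (intro bounded_bilinear.continuous_on[OF bounded_bilinear_blinfun_compose] z
        continuous_on_compose2[OF C1_continuous_on_Df[OF f, of UNIV] y]) auto
next
  fix t :: real and Y Z :: "'a \<Rightarrow>\<^sub>L 'a" assume t: "0 \<le> t"
  have "norm (Df f (y t) o\<^sub>L (Y - Z)) \<le> norm (Df f (y t)) * norm (Y - Z)"
    by (rule norm_blinfun_compose)
  also have "\<dots> \<le> L * norm (Y - Z)" by (intro mult_right_mono yR t) auto
  finally show "norm ((Df f (y t) o\<^sub>L Y) - (Df f (y t) o\<^sub>L Z)) \<le> L * norm (Y - Z)"
    by (simp add: bounded_bilinear.diff_right[OF bounded_bilinear_blinfun_compose])
next
  show "norm (Df f (y t) o\<^sub>L (0 :: 'a \<Rightarrow>\<^sub>L 'a)) \<le> 0" for t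
    by (simp add: bounded_bilinear.zero_right[OF bounded_bilinear_blinfun_compose])
qed blast

section \<open>The Lyapunov integral is continuously differentiable\<close>

lemma exponential_decay_in_DOA:
  assumes "\<And>t. 0 \<le> t \<Longrightarrow> flow_exists f t x"
    and "\<And>t. 0 \<le> t \<Longrightarrow> norm (flow f t x) \<le> C * exp (- \<gamma> * t)" and "0 < \<gamma>"
  shows "x \<in> DOA f"
proof -
  have "((\<lambda>t. C * exp (- \<gamma> * t)) \<longlongrightarrow> 0) at_top"
    using \<open>0 < \<gamma>\<close> by real_asymp
  then have "((\<lambda>t. flow f t x) \<longlongrightarrow> 0) at_top"
    by (rule Lim_null_comparison[rotated])
       (use assms(2) in \<open>auto intro: eventually_mono[OF eventually_ge_at_top[of 0]]\<close>)
  then show ?thesis using assms(1) by (simp add: DOA_def)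
qed

text \<open>This is \<open>robust_tube\<close> for \<open>g = f\<close>, expressed by the flow.\<close>

lemma flow_near_trajectory:
  assumes "f \<in> Fst" and p: "p \<in> DOA f"
  obtains b M a r J d T C where "lyapunov_form b M" and "0 < a" and "0 < r"
    and "lyapunov_form.contracts_on b a {x. b x x \<le> r\<^sup>2} f"
    and "compact J" "0 < d" "0 \<le> T" "0 < C" "ball p d \<subseteq> J" "0 \<in> J"
    and "\<And>x. x \<in> J \<Longrightarrow> forward_solution f (\<lambda>t. flow f t x)"
    and "\<And>x t. x \<in> J \<Longrightarrow> 0 \<le> t \<Longrightarrow> flow_exists f t x"
    and "\<And>x. x \<in> J \<Longrightarrow> flow f 0 x = x"
    and "\<And>x t. x \<in> J \<Longrightarrow> 0 \<le> t \<Longrightarrow> flow f t x \<in> J"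
    and "\<And>x t. x \<in> J \<Longrightarrow> T \<le> t \<Longrightarrow> flow f t x \<in> {x. b x x \<le> r\<^sup>2}"
    and "\<And>x t. x \<in> J \<Longrightarrow> 0 \<le> t \<Longrightarrow> norm (flow f t x) \<le> C * exp (- (a / 2) * t)"
proof -
  have f: "C1_on UNIV f" "f 0 = 0" using assms(1) by (auto simp: Fst_def F0_def)
  obtain b M a r where bM: "lyapunov_form b M" and "0 < a" "0 < r"
    and contr: "lyapunov_form.contracts_on b a {x. b x x \<le> r\<^sup>2} f"
    using stable_equilibrium_form[OF assms(1)] by metis
  interpret lyapunov_form b M by (rule bM)
  obtain J d T C where J: "compact J" "0 < d" "0 \<le> T" "0 < C" "ball p d \<subseteq> J" "{x. b x x \<le> r\<^sup>2} \<subseteq> J"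
    and sol: "\<And>g x. C1_on UNIV g \<Longrightarrow> g 0 = 0 \<Longrightarrow>
        (\<And>x. x \<in> J \<Longrightarrow> norm (g x - f x) \<le> d \<and> norm (Df g x - Df f x) \<le> d) \<Longrightarrow> x \<in> J \<Longrightarrow>
        \<exists>y. y 0 = x \<and> forward_solution g y \<and> (\<forall>t\<ge>0. y t \<in> J) \<and>
          (\<forall>t\<ge>T. y t \<in> {x. b x x \<le> r\<^sup>2}) \<and> (\<forall>t\<ge>0. norm (y t) \<le> C * exp (- (a / 2) * t))"
  proof (rule robust_tube[OF f \<open>0 < a\<close> \<open>0 < r\<close> refl contr p], goal_cases)
    case 1
    show ?case by (rule 1(1)[OF 1(2-)])
  qed
  have main: "forward_solution f (\<lambda>t. flow f t x) \<and> flow f 0 x = x \<and> (\<forall>t\<ge>0. flow_exists f t x \<and>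
      flow f t x \<in> J \<and> norm (flow f t x) \<le> C * exp (- (a / 2) * t)) \<and>
      (\<forall>t\<ge>T. flow f t x \<in> {x. b x x \<le> r\<^sup>2})" if x: "x \<in> J" for x
  proof -
    obtain y where y: "y 0 = x" "forward_solution f y" "\<forall>t\<ge>0. y t \<in> J"
      "\<forall>t\<ge>T. y t \<in> {x. b x x \<le> r\<^sup>2}" "\<forall>t\<ge>0. norm (y t) \<le> C * exp (- (a / 2) * t)"
      using sol[OF f _ x] J(2) by auto
    note fl = forward_solution_flow[OF f(1) y(2), unfolded y(1)]
    show ?thesis
      using flow_forward_solution[OF f(1) fl(1)] y(3-5) fl \<open>0 \<le> T\<close> by auto
  qed
  have "0 \<in> J" using J(6) \<open>0 < r\<close> by auto
  show thesis
    by (rule that[OF bM \<open>0 < a\<close> \<open>0 < r\<close> contr J(1-5) \<open>0 \<in> J\<close>]) (use main in auto)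
qed

lemma norm_blinfun_apply_le:
  assumes "norm A \<le> e"
  shows "norm (blinfun_apply A v) \<le> e * norm v"
  using norm_blinfun[of A v] mult_right_mono[OF assms, of "norm v"] by simp

text \<open>Write \<open>y x\<close> for the trajectory of \<open>x\<close> and \<open>X x\<close> for the solution of the variational equation along it. The
candidate for the derivative is \<open>W x h = \<integral> D\<psi> (y x t) (X x t h) dt\<close>. Four applications of the same estimate
bound, uniformly for \<open>x\<close> and \<open>x'\<close> in \<open>J\<close> and with the same exponential rate, the difference \<open>y x' - y x\<close>,
the solution \<open>X x h\<close>, the remainder \<open>y x' - y x - X x (x' - x)\<close> and the difference \<open>X x' h - X x h\<close>. The last two carry a
factor \<open>\<epsilon>\<close>, because their perturbation terms are governed by the modulus of continuity of the
derivative of \<open>f\<close> along differences that have already been bounded. Integration yields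
differentiability and continuity of the derivative from the last two bounds.\<close>

lemma Lyapunov_integral_C1_near:
  fixes \<psi> :: "real^'n \<Rightarrow> real"
  assumes fst: "f \<in> Fst" and psi: "C1_on UNIV \<psi>" "\<psi> 0 = 0" and p: "p \<in> DOA f"
  shows "\<exists>e>0. ball p e \<subseteq> DOA f \<and> C1_on (ball p e) (V f \<psi>) \<and> V_defined f \<psi> p"
proof -
  have f: "C1_on UNIV f" "f 0 = 0" using fst by (auto simp: Fst_def F0_def)
  obtain b M a r J d T C where bM: "lyapunov_form b M" and "0 < a" and "0 < r"
    and contr: "lyapunov_form.contracts_on b a {x. b x x \<le> r\<^sup>2} f"
    and "compact J" "0 < d" "0 \<le> T" "0 < C" "ball p d \<subseteq> J" "0 \<in> J"
    and sol: "\<And>x. x \<in> J \<Longrightarrow> forward_solution f (\<lambda>t. flow f t x)"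
    and ex: "\<And>x t. x \<in> J \<Longrightarrow> 0 \<le> t \<Longrightarrow> flow_exists f t x"
    and start: "\<And>x. x \<in> J \<Longrightarrow> flow f 0 x = x"
    and stay: "\<And>x t. x \<in> J \<Longrightarrow> 0 \<le> t \<Longrightarrow> flow f t x \<in> J"
    and late: "\<And>x t. x \<in> J \<Longrightarrow> T \<le> t \<Longrightarrow> flow f t x \<in> {x. b x x \<le> r\<^sup>2}"
    and bound: "\<And>x t. x \<in> J \<Longrightarrow> 0 \<le> t \<Longrightarrow> norm (flow f t x) \<le> C * exp (- (a / 2) * t)"
  proof (rule flow_near_trajectory[OF fst p], goal_cases)
    case 1
    show ?case by (rule 1(1)[OF 1(2-)])
  qed
  interpret lyapunov_form b M by (rule bM)
  let ?B = "{x. b x x \<le> r\<^sup>2}"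
  define y where "y x t = flow f t x" for x t
  have dy: "(y x has_vector_derivative f (y x t)) (at t within {0..})" if "x \<in> J" "0 \<le> t" for x t
    using sol that by (auto simp: forward_solution_def y_def[abs_def])
  have conty: "continuous_on {0..} (y x)" if "x \<in> J" for x
    by (rule forward_curve_continuous_on[OF dy[OF that]]) auto
  obtain R where "\<And>x. x \<in> J \<Longrightarrow> norm x \<le> R"
    using compact_imp_bounded[OF \<open>compact J\<close>] unfolding bounded_iff by blast
  then have R: "J \<subseteq> cball 0 R" by auto
  have yR: "y x t \<in> cball 0 R" if "x \<in> J" "0 \<le> t" for x t
    using stay[OF that] R by (auto simp: y_def)
  have ylate: "y x t \<in> ?B" if "x \<in> J" "T \<le> t" for x t
    using late[OF that] by (simp add: y_def)
  have y0: "y x 0 = x" if "x \<in> J" for x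
    using start[OF that] by (simp add: y_def)
  obtain L where "L \<ge> 0"
    and L: "\<And>x y. x \<in> cball 0 R \<Longrightarrow> y \<in> cball 0 R \<Longrightarrow> norm (f x - f y) \<le> L * norm (x - y)"
      "\<And>x. x \<in> cball 0 R \<Longrightarrow> norm (Df f x) \<le> L"
    using C1_Lipschitz_on_cball[OF f(1)] by metis
  obtain N where "N \<ge> 0"
    and N: "\<And>x y. x \<in> cball 0 R \<Longrightarrow> y \<in> cball 0 R \<Longrightarrow> norm (\<psi> x - \<psi> y) \<le> N * norm (x - y)"
      "\<And>x. x \<in> cball 0 R \<Longrightarrow> norm (Df \<psi> x) \<le> N"
    using C1_Lipschitz_on_cball[OF psi(1)] by metis
  have "\<exists>X. X 0 = id_blinfun \<and>
      (\<forall>t\<ge>0. (X has_vector_derivative Df f (y x t) o\<^sub>L X t) (at t within {0..}))" if "x \<in> J" for x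
    using variational_solution[OF f(1) conty[OF that]] L(2)[OF yR[OF that]] by blast
  then obtain X where X0: "\<And>x. x \<in> J \<Longrightarrow> X x 0 = id_blinfun"
    and dX: "\<And>x t. x \<in> J \<Longrightarrow> 0 \<le> t \<Longrightarrow>
      (X x has_vector_derivative Df f (y x t) o\<^sub>L X x t) (at t within {0..})"
    by metis
  have dXh: "((\<lambda>t. X x t h) has_vector_derivative Df f (y x t) (X x t h)) (at t within {0..})"
    if "x \<in> J" "0 \<le> t" for x t h
    using bounded_linear.has_vector_derivative[OF blinfun.bounded_linear_left dX[OF that], of h] by simp
  have contXh: "continuous_on {0..} (\<lambda>t. X x t h)" if "x \<in> J" for x h
    by (rule forward_curve_continuous_on[OF dXh[OF that]]) auto
  have Df_L: "norm (Df f (y x t) v) \<le> L * norm v" if "x \<in> J" "0 \<le> t" for x t v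
    by (intro norm_blinfun_apply_le L yR that)
  have Df_contr: "b v (Df f (y x t) v) \<le> - a * b v v" if "x \<in> J" "T \<le> t" for x t v
    using contr ylate[OF that] unfolding contracts_on_def by blast
  define \<theta> where "\<theta> = a / 4"
  have "0 < \<theta>" using \<open>0 < a\<close> by (simp add: \<theta>_def)
  obtain C1 where "C1 > 0" and est:
    "\<And>w m n \<kappa> t. (\<And>t. 0 \<le> t \<Longrightarrow> (w has_vector_derivative m t + n t) (at t within {0..})) \<Longrightarrow>
      (\<And>t. 0 \<le> t \<Longrightarrow> norm (m t) \<le> L * norm (w t)) \<Longrightarrow>
      (\<And>t. T \<le> t \<Longrightarrow> b (w t) (m t) \<le> - a * b (w t) (w t)) \<Longrightarrow>
      0 \<le> \<kappa> \<Longrightarrow> (\<And>t. 0 \<le> t \<Longrightarrow> norm (n t) \<le> \<kappa> * exp (- \<theta> * t)) \<Longrightarrow> 0 \<le> t \<Longrightarrow>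
      norm (w t) \<le> C1 * (norm (w 0) + \<kappa>) * exp (- \<theta> * t)"
  proof (rule exponential_estimate[OF \<open>0 < a\<close> \<open>0 \<le> T\<close> \<open>0 \<le> L\<close>, folded \<theta>_def], goal_cases)
    case 1
    show ?case by (rule 1(1)[OF 1(2-)])
  qed
  have exp1: "exp (- \<theta> * t) \<le> 1" if "0 \<le> t" for t
    using that \<open>0 < \<theta>\<close> by simp
  have est_y: "norm (y x' t - y x t) \<le> C1 * norm (x' - x) * exp (- \<theta> * t)"
    if x: "x \<in> J" "x' \<in> J" and t: "0 \<le> t" for x x' t
  proof -
    have "norm (y x' t - y x t) \<le> C1 * (norm (y x' 0 - y x 0) + 0) * exp (- \<theta> * t)"
    proof (rule est[where w = "\<lambda>t. y x' t - y x t" and m = "\<lambda>t. f (y x' t) - f (y x t)" and n = "\<lambda>t. 0"])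
      fix t :: real assume t: "0 \<le> t"
      show "((\<lambda>t. y x' t - y x t) has_vector_derivative f (y x' t) - f (y x t) + 0) (at t within {0..})"
        using has_vector_derivative_diff[OF dy[OF x(2) t] dy[OF x(1) t]] by simp
      show "norm (f (y x' t) - f (y x t)) \<le> L * norm (y x' t - y x t)"
        by (intro L yR x t)
    next
      fix t assume t: "T \<le> t"
      show "b (y x' t - y x t) (f (y x' t) - f (y x t)) \<le> - a * b (y x' t - y x t) (y x' t - y x t)"
        by (intro contracts_on_increment[OF contr f(1) sublevel_convex] ylate x t)
    qed (use t in auto)
    then show ?thesis using y0 x by simp
  qed
  have est_X: "norm (X x t h) \<le> C1 * norm h * exp (- \<theta> * t)" if x: "x \<in> J" and t: "0 \<le> t" for x t h
  proof -
    have "norm (X x t h) \<le> C1 * (norm (X x 0 h) + 0) * exp (- \<theta> * t)"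
      by (rule est[where w = "\<lambda>t. X x t h" and m = "\<lambda>t. Df f (y x t) (X x t h)" and n = "\<lambda>t. 0"])
         (use x t dXh Df_L Df_contr in auto)
    then show ?thesis using X0 x by simp
  qed
  have est_e: "norm (y x' t - y x t - X x t (x' - x)) \<le> C1 * (\<epsilon> * (C1 * norm (x' - x))) * exp (- \<theta> * t)"
    if x: "x \<in> J" "x' \<in> J" and t: "0 \<le> t" and "0 \<le> \<epsilon>"
      and mod: "\<And>z z'. z \<in> cball 0 R \<Longrightarrow> z' \<in> cball 0 R \<Longrightarrow> norm (z' - z) < \<delta> \<Longrightarrow> norm (Df f z' - Df f z) \<le> \<epsilon>"
      and close: "C1 * norm (x' - x) < \<delta>" for x x' t \<epsilon> \<delta>
  proof -
    let ?h = "x' - x"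
    let ?n = "\<lambda>t. f (y x' t) - f (y x t) - Df f (y x t) (y x' t - y x t)"
    have "norm (y x' t - y x t - X x t ?h)
        \<le> C1 * (norm (y x' 0 - y x 0 - X x 0 ?h) + \<epsilon> * (C1 * norm ?h)) * exp (- \<theta> * t)"
    proof (rule est[where w = "\<lambda>t. y x' t - y x t - X x t ?h" and n = ?n
          and m = "\<lambda>t. Df f (y x t) (y x' t - y x t - X x t ?h)"])
      fix t :: real assume t: "0 \<le> t"
      have eq: "Df f (y x t) (y x' t - y x t - X x t ?h) + ?n t
          = f (y x' t) - f (y x t) - Df f (y x t) (X x t ?h)"
        by (simp add: blinfun.diff_right)
      show "((\<lambda>t. y x' t - y x t - X x t ?h) has_vector_derivative
          Df f (y x t) (y x' t - y x t - X x t ?h) + ?n t) (at t within {0..})"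
        unfolding eq
        by (rule has_vector_derivative_diff[OF has_vector_derivative_diff[OF dy[OF x(2) t] dy[OF x(1) t]]
            dXh[OF x(1) t, of ?h]])
      have u: "norm (y x' t - y x t) \<le> C1 * norm ?h * exp (- \<theta> * t)"
        by (rule est_y[OF x t])
      also have "\<dots> \<le> C1 * norm ?h * 1"
        using \<open>C1 > 0\<close> exp1[OF t] by (intro mult_left_mono) auto
      finally have u': "norm (y x' t - y x t) < \<delta>" using close by simp
      have "norm (?n t) \<le> \<epsilon> * norm (y x' t - y x t)"
        by (rule C1_linearization[OF f(1) yR[OF x(1) t] yR[OF x(2) t]])
           (use mod[OF yR[OF x(1) t]] u' in auto)
      also have "\<dots> \<le> \<epsilon> * (C1 * norm ?h * exp (- \<theta> * t))"
        using u \<open>0 \<le> \<epsilon>\<close> by (intro mult_left_mono) auto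
      finally show "norm (?n t) \<le> \<epsilon> * (C1 * norm ?h) * exp (- \<theta> * t)"
        by (simp add: mult.assoc)
    qed (use x t Df_L Df_contr \<open>0 \<le> \<epsilon>\<close> \<open>C1 > 0\<close> in auto)
    then show ?thesis using X0 y0 x by simp
  qed
  have est_E: "norm (X x' t h - X x t h) \<le> C1 * (\<epsilon> * (C1 * norm h)) * exp (- \<theta> * t)"
    if x: "x \<in> J" "x' \<in> J" and t: "0 \<le> t" and "0 \<le> \<epsilon>"
      and mod: "\<And>z z'. z \<in> cball 0 R \<Longrightarrow> z' \<in> cball 0 R \<Longrightarrow> norm (z' - z) < \<delta> \<Longrightarrow> norm (Df f z' - Df f z) \<le> \<epsilon>"
      and close: "C1 * norm (x' - x) < \<delta>" for x x' t \<epsilon> \<delta> h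
  proof -
    let ?n = "\<lambda>t. (Df f (y x' t) - Df f (y x t)) (X x' t h)"
    have "norm (X x' t h - X x t h)
        \<le> C1 * (norm (X x' 0 h - X x 0 h) + \<epsilon> * (C1 * norm h)) * exp (- \<theta> * t)"
    proof (rule est[where w = "\<lambda>t. X x' t h - X x t h" and n = ?n
          and m = "\<lambda>t. Df f (y x t) (X x' t h - X x t h)"])
      fix t :: real assume t: "0 \<le> t"
      show "((\<lambda>t. X x' t h - X x t h) has_vector_derivative
          Df f (y x t) (X x' t h - X x t h) + ?n t) (at t within {0..})"
        using has_vector_derivative_diff[OF dXh[OF x(2) t, of h] dXh[OF x(1) t, of h]]
        by (simp add: blinfun.diff_right blinfun.diff_left)
      have "norm (y x' t - y x t) \<le> C1 * norm (x' - x) * exp (- \<theta> * t)"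
        by (rule est_y[OF x t])
      also have "\<dots> \<le> C1 * norm (x' - x) * 1"
        using \<open>C1 > 0\<close> exp1[OF t] by (intro mult_left_mono) auto
      finally have "norm (Df f (y x' t) - Df f (y x t)) \<le> \<epsilon>"
        using close by (intro mod yR x t) simp
      then have "norm (?n t) \<le> \<epsilon> * norm (X x' t h)"
        by (rule norm_blinfun_apply_le)
      also have "\<dots> \<le> \<epsilon> * (C1 * norm h * exp (- \<theta> * t))"
        using est_X[OF x(2) t] \<open>0 \<le> \<epsilon>\<close> by (intro mult_left_mono) auto
      finally show "norm (?n t) \<le> \<epsilon> * (C1 * norm h) * exp (- \<theta> * t)"
        by (simp add: mult.assoc)
    qed (use x t Df_L Df_contr \<open>0 \<le> \<epsilon>\<close> \<open>C1 > 0\<close> in auto)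
    then show ?thesis using X0 x by simp
  qed
  have contpsi: "continuous_on {0..} (\<lambda>t. \<psi> (y x t))" if "x \<in> J" for x
    by (rule continuous_on_compose2[OF C1_continuous_on[OF psi(1), of UNIV] conty[OF that]]) auto
  have contDpsi: "continuous_on {0..} (\<lambda>t. Df \<psi> (y x t) (X x t h))" if "x \<in> J" for x h
    by (intro bounded_bilinear.continuous_on[OF bounded_bilinear_blinfun_apply] contXh that
        continuous_on_compose2[OF C1_continuous_on_Df[OF psi(1), of UNIV] conty[OF that]]) auto
  have intpsi: "(\<lambda>t. \<psi> (y x t)) integrable_on {0..}" if x: "x \<in> J" for x
  proof (rule exponentially_bounded_integral(1)[OF contpsi[OF x], where K = "N * C" and \<gamma> = "a / 2"])
    fix t :: real assume t: "0 \<le> t"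
    have "\<bar>\<psi> (y x t) - \<psi> 0\<bar> \<le> N * norm (y x t - 0)"
      using N(1)[OF yR[OF x t], of 0] R \<open>0 \<in> J\<close> by auto
    also have "\<dots> \<le> N * (C * exp (- (a / 2) * t))"
      using bound[OF x t] \<open>N \<ge> 0\<close> by (intro mult_left_mono) (auto simp: y_def)
    finally show "\<bar>\<psi> (y x t)\<bar> \<le> N * C * exp (- (a / 2) * t)"
      by (simp add: psi(2))
  qed (use \<open>0 < a\<close> in auto)
  have bDpsi: "\<bar>Df \<psi> (y x t) v\<bar> \<le> N * norm v" if "x \<in> J" "0 \<le> t" for x t v
    using norm_blinfun_apply_le[OF N(2)[OF yR[OF that]], of v] by simp
  define W where "W x h = integral {0..} (\<lambda>t. Df \<psi> (y x t) (X x t h))" for x h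
  have intDpsi: "(\<lambda>t. Df \<psi> (y x t) (X x t h)) integrable_on {0..}"
    and boundW: "\<bar>W x h\<bar> \<le> N * (C1 * norm h) / \<theta>" if x: "x \<in> J" for x h
  proof -
    have "\<bar>Df \<psi> (y x t) (X x t h)\<bar> \<le> N * (C1 * norm h) * exp (- \<theta> * t)" if t: "0 \<le> t" for t
      using bDpsi[OF x t, of "X x t h"] mult_left_mono[OF est_X[OF x t] \<open>N \<ge> 0\<close>, of h]
      by (simp add: mult.assoc)
    from exponentially_bounded_integral[OF contDpsi[OF x] this \<open>0 < \<theta>\<close>]
    show "(\<lambda>t. Df \<psi> (y x t) (X x t h)) integrable_on {0..}" "\<bar>W x h\<bar> \<le> N * (C1 * norm h) / \<theta>"
      by (auto simp: W_def)
  qed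
  have linW: "bounded_linear (W x)" if x: "x \<in> J" for x
  proof (rule bounded_linear_intro[where K = "N * C1 / \<theta>"])
    fix h k :: "real^'n" and c :: real
    show "W x (h + k) = W x h + W x k"
      unfolding W_def by (simp add: blinfun.add_right integral_add intDpsi[OF x])
    show "W x (c *\<^sub>R h) = c *\<^sub>R W x h"
      unfolding W_def by (simp add: blinfun.scaleR_right)
    show "norm (W x h) \<le> norm h * (N * C1 / \<theta>)"
      using boundW[OF x, of h] by (simp add: mult_ac)
  qed
  have V_y: "V f \<psi> x = integral {0..} (\<lambda>t. \<psi> (y x t))" for x
    by (simp add: V_def y_def)
  define Q where "Q = (C1 + N * C1 * C1) / \<theta>"
  have "Q > 0" using \<open>C1 > 0\<close> \<open>N \<ge> 0\<close> \<open>0 < \<theta>\<close> by (simp add: Q_def add_pos_nonneg)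
  have modulus: "\<exists>\<delta>>0. \<forall>x\<in>J. \<forall>x'\<in>J. norm (x' - x) < \<delta> \<longrightarrow>
      \<bar>V f \<psi> x' - V f \<psi> x - W x (x' - x)\<bar> \<le> e * norm (x' - x) \<and>
      (\<forall>h. \<bar>W x' h - W x h\<bar> \<le> e * norm h)" if "e > 0" for e
  proof -
    define \<epsilon> where "\<epsilon> = e / Q"
    have "\<epsilon> > 0" using \<open>e > 0\<close> \<open>Q > 0\<close> by (simp add: \<epsilon>_def)
    have Qe: "(\<epsilon> * C1 + N * (C1 * (\<epsilon> * C1))) / \<theta> = e"
    proof -
      have "(\<epsilon> * C1 + N * (C1 * (\<epsilon> * C1))) / \<theta> = \<epsilon> * Q"
        by (simp add: Q_def algebra_simps)
      then show ?thesis using \<open>Q > 0\<close> by (simp add: \<epsilon>_def)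
    qed
    obtain d1 where "0 < d1" and d1: "\<And>z z'. z \<in> cball 0 R \<Longrightarrow> z' \<in> cball 0 R \<Longrightarrow>
        norm (z' - z) < d1 \<Longrightarrow> norm (Df f z' - Df f z) \<le> \<epsilon>"
      using C1_modulus[OF f(1) \<open>\<epsilon> > 0\<close>, of R] by blast
    obtain d2 where "0 < d2" and d2: "\<And>z z'. z \<in> cball 0 R \<Longrightarrow> z' \<in> cball 0 R \<Longrightarrow>
        norm (z' - z) < d2 \<Longrightarrow> norm (Df \<psi> z' - Df \<psi> z) \<le> \<epsilon>"
      using C1_modulus[OF psi(1) \<open>\<epsilon> > 0\<close>, of R] by blast
    define \<delta> where "\<delta> = min d1 d2 / C1"
    have "\<delta> > 0" using \<open>0 < d1\<close> \<open>0 < d2\<close> \<open>C1 > 0\<close> by (simp add: \<delta>_def)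
    have "\<bar>V f \<psi> x' - V f \<psi> x - W x (x' - x)\<bar> \<le> e * norm (x' - x) \<and>
      (\<forall>h. \<bar>W x' h - W x h\<bar> \<le> e * norm h)"
      if x: "x \<in> J" "x' \<in> J" and xx: "norm (x' - x) < \<delta>" for x x'
    proof -
      have C1xx: "C1 * norm (x' - x) < d1" "C1 * norm (x' - x) < d2"
        using xx \<open>C1 > 0\<close> by (auto simp: \<delta>_def field_simps)
      have yy: "norm (y x' t - y x t) < d2" if t: "0 \<le> t" for t
      proof -
        have "norm (y x' t - y x t) \<le> C1 * norm (x' - x) * exp (- \<theta> * t)"
          by (rule est_y[OF x t])
        also have "\<dots> \<le> C1 * norm (x' - x) * 1"
          using \<open>C1 > 0\<close> exp1[OF t] by (intro mult_left_mono) auto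
        finally show ?thesis using C1xx by simp
      qed
      have "\<bar>V f \<psi> x' - V f \<psi> x - W x (x' - x)\<bar> \<le> e * norm (x' - x)"
      proof -
        let ?q = "\<lambda>t. \<psi> (y x' t) - \<psi> (y x t) - Df \<psi> (y x t) (X x t (x' - x))"
        have q_bound: "\<bar>?q t\<bar> \<le> ((\<epsilon> * C1 + N * (C1 * (\<epsilon> * C1))) * norm (x' - x)) * exp (- \<theta> * t)"
          if t: "0 \<le> t" for t
        proof -
          let ?u = "y x' t - y x t"
          have "norm (\<psi> (y x' t) - \<psi> (y x t) - Df \<psi> (y x t) ?u) \<le> \<epsilon> * norm ?u"
            by (rule C1_linearization[OF psi(1) yR[OF x(1) t] yR[OF x(2) t]])
               (use d2[OF yR[OF x(1) t]] yy[OF t] in auto)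
          also have "\<dots> \<le> \<epsilon> * (C1 * norm (x' - x) * exp (- \<theta> * t))"
            using est_y[OF x t] \<open>\<epsilon> > 0\<close> by (intro mult_left_mono) auto
          finally have 1: "\<bar>\<psi> (y x' t) - \<psi> (y x t) - Df \<psi> (y x t) ?u\<bar>
              \<le> \<epsilon> * (C1 * norm (x' - x) * exp (- \<theta> * t))" by simp
          have "\<bar>Df \<psi> (y x t) (?u - X x t (x' - x))\<bar> \<le> N * norm (?u - X x t (x' - x))"
            by (rule bDpsi[OF x(1) t])
          also have "\<dots> \<le> N * (C1 * (\<epsilon> * (C1 * norm (x' - x))) * exp (- \<theta> * t))"
            using \<open>N \<ge> 0\<close> \<open>\<epsilon> > 0\<close> by (intro mult_left_mono est_e[OF x t _ d1 C1xx(1)]) auto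
          finally have 2: "\<bar>Df \<psi> (y x t) (?u - X x t (x' - x))\<bar>
              \<le> N * (C1 * (\<epsilon> * (C1 * norm (x' - x))) * exp (- \<theta> * t))" .
          have "?q t = (\<psi> (y x' t) - \<psi> (y x t) - Df \<psi> (y x t) ?u)
              + Df \<psi> (y x t) (?u - X x t (x' - x))"
            by (simp add: blinfun.diff_right)
          moreover have "((\<epsilon> * C1 + N * (C1 * (\<epsilon> * C1))) * norm (x' - x)) * exp (- \<theta> * t)
              = \<epsilon> * (C1 * norm (x' - x) * exp (- \<theta> * t)) + N * (C1 * (\<epsilon> * (C1 * norm (x' - x))) * exp (- \<theta> * t))"
            by (simp add: algebra_simps)
          ultimately show ?thesis
            by (simp only: order_trans[OF abs_triangle_ineq add_mono[OF 1 2]])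
        qed
        have "V f \<psi> x' - V f \<psi> x - W x (x' - x) = integral {0..} ?q"
          unfolding V_y W_def
          by (simp add: integral_diff integrable_diff intpsi[OF x(1)] intpsi[OF x(2)] intDpsi[OF x(1)])
        moreover have "continuous_on {0..} ?q"
          by (intro continuous_on_diff contpsi contDpsi x)
        ultimately show ?thesis
          using exponentially_bounded_integral(2)[OF _ q_bound \<open>0 < \<theta>\<close>] Qe
          by (simp flip: times_divide_eq_left)
      qed
      moreover have "\<bar>W x' h - W x h\<bar> \<le> e * norm h" for h
      proof -
        let ?q = "\<lambda>t. Df \<psi> (y x' t) (X x' t h) - Df \<psi> (y x t) (X x t h)"
        have q_bound: "\<bar>?q t\<bar> \<le> ((\<epsilon> * C1 + N * (C1 * (\<epsilon> * C1))) * norm h) * exp (- \<theta> * t)"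
          if t: "0 \<le> t" for t
        proof -
          have "norm (Df \<psi> (y x' t) - Df \<psi> (y x t)) \<le> \<epsilon>"
            by (intro d2 yR x t yy)
          then have "norm ((Df \<psi> (y x' t) - Df \<psi> (y x t)) (X x' t h)) \<le> \<epsilon> * norm (X x' t h)"
            by (rule norm_blinfun_apply_le)
          also have "\<dots> \<le> \<epsilon> * (C1 * norm h * exp (- \<theta> * t))"
            using est_X[OF x(2) t] \<open>\<epsilon> > 0\<close> by (intro mult_left_mono) auto
          finally have 1: "\<bar>(Df \<psi> (y x' t) - Df \<psi> (y x t)) (X x' t h)\<bar>
              \<le> \<epsilon> * (C1 * norm h * exp (- \<theta> * t))" by simp
          have "\<bar>Df \<psi> (y x t) (X x' t h - X x t h)\<bar> \<le> N * norm (X x' t h - X x t h)"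
            by (rule bDpsi[OF x(1) t])
          also have "\<dots> \<le> N * (C1 * (\<epsilon> * (C1 * norm h)) * exp (- \<theta> * t))"
            using \<open>N \<ge> 0\<close> \<open>\<epsilon> > 0\<close> by (intro mult_left_mono est_E[OF x t _ d1 C1xx(1)]) auto
          finally have 2: "\<bar>Df \<psi> (y x t) (X x' t h - X x t h)\<bar>
              \<le> N * (C1 * (\<epsilon> * (C1 * norm h)) * exp (- \<theta> * t))" .
          have "?q t = (Df \<psi> (y x' t) - Df \<psi> (y x t)) (X x' t h)
              + Df \<psi> (y x t) (X x' t h - X x t h)"
            by (simp add: blinfun.diff_right blinfun.diff_left)
          moreover have "((\<epsilon> * C1 + N * (C1 * (\<epsilon> * C1))) * norm h) * exp (- \<theta> * t)
              = \<epsilon> * (C1 * norm h * exp (- \<theta> * t)) + N * (C1 * (\<epsilon> * (C1 * norm h)) * exp (- \<theta> * t))"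
            by (simp add: algebra_simps)
          ultimately show ?thesis
            by (simp only: order_trans[OF abs_triangle_ineq add_mono[OF 1 2]])
        qed
        have "W x' h - W x h = integral {0..} ?q"
          unfolding W_def by (simp add: integral_diff intDpsi[OF x(1)] intDpsi[OF x(2)])
        moreover have "continuous_on {0..} ?q"
          by (intro continuous_on_diff contDpsi x)
        ultimately show ?thesis
          using exponentially_bounded_integral(2)[OF _ q_bound \<open>0 < \<theta>\<close>] Qe
          by (simp flip: times_divide_eq_left)
      qed
      ultimately show ?thesis by blast
    qed
    with \<open>\<delta> > 0\<close> show ?thesis by blast
  qed
  have dV: "(V f \<psi> has_derivative W x) (at x)" if x: "x \<in> ball p d" for x
    unfolding has_derivative_at_alt
  proof (intro conjI allI impI)
    have "x \<in> J" using x \<open>ball p d \<subseteq> J\<close> by blast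
    then show "bounded_linear (W x)" by (rule linW)
    fix e :: real assume "0 < e"
    then obtain \<delta> where "\<delta> > 0" and \<delta>: "\<And>x'. x' \<in> J \<Longrightarrow> norm (x' - x) < \<delta> \<Longrightarrow>
      \<bar>V f \<psi> x' - V f \<psi> x - W x (x' - x)\<bar> \<le> e * norm (x' - x)"
      using modulus \<open>x \<in> J\<close> by blast
    obtain s where "s > 0" "ball x s \<subseteq> ball p d"
      using x open_ball open_contains_ball by blast
    then show "\<exists>d>0. \<forall>x'. norm (x' - x) < d \<longrightarrow>
        norm (V f \<psi> x' - V f \<psi> x - W x (x' - x)) \<le> e * norm (x' - x)"
      using \<delta> \<open>\<delta> > 0\<close> \<open>ball p d \<subseteq> J\<close>
      by (intro exI[of _ "min \<delta> s"]) (auto simp: subset_iff dist_norm norm_minus_commute)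
  qed
  have "continuous_on (ball p d) (Df (V f \<psi>))"
    unfolding continuous_on_iff
  proof (intro ballI allI impI)
    fix x and e :: real assume x: "x \<in> ball p d" and "0 < e"
    then obtain \<delta> where "\<delta> > 0" and \<delta>: "\<And>x' h. x' \<in> J \<Longrightarrow> norm (x' - x) < \<delta> \<Longrightarrow>
      \<bar>W x' h - W x h\<bar> \<le> e / 2 * norm h"
      using modulus[of "e / 2"] \<open>ball p d \<subseteq> J\<close> by (meson half_gt_zero subsetD)
    have "dist (Df (V f \<psi>) x') (Df (V f \<psi>) x) < e" if x': "x' \<in> ball p d" "dist x' x < \<delta>" for x'
    proof -
      have "norm (Df (V f \<psi>) x' - Df (V f \<psi>) x) \<le> e / 2"
      proof (rule norm_blinfun_bound)
        fix h
        show "norm ((Df (V f \<psi>) x' - Df (V f \<psi>) x) h) \<le> e / 2 * norm h"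
          using \<delta>[of x' h] x' \<open>ball p d \<subseteq> J\<close>
          by (auto simp: blinfun.diff_left blinfun_apply_Df[OF dV[OF x]] blinfun_apply_Df[OF dV[OF x'(1)]] dist_norm)
      qed (use \<open>0 < e\<close> in auto)
      then show ?thesis using \<open>0 < e\<close> by (simp add: dist_norm)
    qed
    with \<open>\<delta> > 0\<close> show "\<exists>d'>0. \<forall>x'\<in>ball p d. dist x' x < d' \<longrightarrow> dist (Df (V f \<psi>) x') (Df (V f \<psi>) x) < e"
      by blast
  qed
  then have "C1_on (ball p d) (V f \<psi>)"
    unfolding C1_on_def using dV differentiable_def by blast
  moreover have "ball p d \<subseteq> DOA f"
  proof
    fix x assume "x \<in> ball p d"
    then have x: "x \<in> J" using \<open>ball p d \<subseteq> J\<close> by blast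
    show "x \<in> DOA f"
      by (rule exponential_decay_in_DOA[OF ex[OF x] bound[OF x]]) (use \<open>0 < a\<close> in auto)
  qed
  moreover have "V_defined f \<psi> p"
  proof -
    have "p \<in> J" using \<open>0 < d\<close> \<open>ball p d \<subseteq> J\<close> by auto
    then show ?thesis
      using ex[of p] intpsi[of p] by (simp add: V_defined_def y_def)
  qed
  ultimately show ?thesis using \<open>0 < d\<close> by blast
qed


lemma Lyapunov_integral_C1:
  fixes \<psi> :: "real^'n \<Rightarrow> real"
  assumes "f \<in> Fst" and "C1_on UNIV \<psi>" "\<psi> 0 = 0"
  shows "open (DOA f)" and "C1_on (DOA f) (V f \<psi>)" and "\<And>x. x \<in> DOA f \<Longrightarrow> V_defined f \<psi> x"
proof -
  note near = Lyapunov_integral_C1_near[OF assms]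
  show op: "open (DOA f)"
    unfolding open_contains_ball using near by blast
  show "V_defined f \<psi> x" if "x \<in> DOA f" for x
    using near[OF that] by blast
  have "V f \<psi> differentiable (at x) \<and> isCont (Df (V f \<psi>)) x" if x: "x \<in> DOA f" for x
  proof -
    obtain e where "e > 0" and e: "C1_on (ball x e) (V f \<psi>)" using near[OF x] by blast
    then have "x \<in> ball x e" by simp
    then show ?thesis
      using e continuous_on_eq_continuous_at[OF open_ball[of x e]] unfolding C1_on_def by blast
  qed
  then show "C1_on (DOA f) (V f \<psi>)"
    unfolding C1_on_def by (simp add: continuous_on_eq_continuous_at[OF op])
qed

section \<open>Continuity of the Lyapunov solution operator\<close>

text \<open>Every tube contains a ball around its starting point, so finitely many tubes cover \<open>K\<close>; a finite union
of robustly invariant sets is robustly invariant. The tube of the point 0 is always included, which makes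
\<open>J\<close> a neighbourhood of 0 even if \<open>K\<close> is empty.\<close>

lemma robust_basin:
  assumes fst: "f \<in> Fst" and K: "compact K" "K \<subseteq> DOA f"
  obtains J d \<gamma> C r where "compact J" "K \<subseteq> J" "0 < d" "0 < \<gamma>" "0 < r" "ball 0 r \<subseteq> J"
    and "\<And>g x. C1_on UNIV g \<Longrightarrow> g 0 = 0 \<Longrightarrow>
        (\<And>x. x \<in> J \<Longrightarrow> norm (g x - f x) \<le> d \<and> norm (Df g x - Df f x) \<le> d) \<Longrightarrow> x \<in> J \<Longrightarrow>
        forward_solution g (\<lambda>t. flow g t x) \<and> flow g 0 x = x \<and>
        (\<forall>t\<ge>0. flow_exists g t x \<and> flow g t x \<in> J \<and> norm (flow g t x) \<le> C * exp (- \<gamma> * t))"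
proof -
  have f: "C1_on UNIV f" "f 0 = 0" using fst by (auto simp: Fst_def F0_def)
  obtain b M a r where bM: "lyapunov_form b M" and "0 < a" "0 < r"
    and contr: "lyapunov_form.contracts_on b a {x. b x x \<le> r\<^sup>2} f"
    using stable_equilibrium_form[OF fst] by metis
  interpret lyapunov_form b M by (rule bM)
  define good where "good J d C \<longleftrightarrow> (\<forall>g x. C1_on UNIV g \<longrightarrow> g 0 = 0 \<longrightarrow>
      (\<forall>x\<in>J. norm (g x - f x) \<le> d \<and> norm (Df g x - Df f x) \<le> d) \<longrightarrow> x \<in> J \<longrightarrow>
      (\<exists>y. y 0 = x \<and> forward_solution g y \<and> (\<forall>t\<ge>0. y t \<in> J) \<and>
        (\<forall>t\<ge>0. norm (y t) \<le> C * exp (- (a / 2) * t))))" for J d C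
  have "\<exists>J d C. compact J \<and> 0 < d \<and> 0 < C \<and> ball p d \<subseteq> J \<and> good J d C" if "p \<in> DOA f" for p
  proof (rule robust_tube[OF f \<open>0 < a\<close> \<open>0 < r\<close> refl contr that], goal_cases)
    case (1 J d T C)
    have "good J d C"
      unfolding good_def
    proof (intro allI impI)
      fix g x
      assume "C1_on UNIV g" "g 0 = 0" "x \<in> J"
        and "\<forall>x\<in>J. norm (g x - f x) \<le> d \<and> norm (Df g x - Df f x) \<le> d"
      then obtain y where "y 0 = x \<and> forward_solution g y \<and> (\<forall>t\<ge>0. y t \<in> J) \<and>
          (\<forall>t\<ge>T. y t \<in> {x. b x x \<le> r\<^sup>2}) \<and> (\<forall>t\<ge>0. norm (y t) \<le> C * exp (- (a / 2) * t))"
        using 1(7)[of g x] by auto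
      then show "\<exists>y. y 0 = x \<and> forward_solution g y \<and> (\<forall>t\<ge>0. y t \<in> J) \<and>
          (\<forall>t\<ge>0. norm (y t) \<le> C * exp (- (a / 2) * t))"
        by blast
    qed
    with 1(1-6) show ?case by blast
  qed
  then obtain J d C where JdC: "\<And>p. p \<in> DOA f \<Longrightarrow>
      compact (J p) \<and> 0 < d p \<and> 0 < C p \<and> ball p (d p) \<subseteq> J p \<and> good (J p) (d p) (C p)"
    by metis
  obtain K' where K': "K' \<subseteq> K" "finite K'" "K \<subseteq> (\<Union>p\<in>K'. ball p (d p))"
  proof (rule compactE_image[OF K(1), of K "\<lambda>p. ball p (d p)"])
    show "K \<subseteq> (\<Union>p\<in>K. ball p (d p))"
    proof
      fix x assume "x \<in> K"
      with JdC K(2) have "x \<in> ball x (d x)" by auto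
      with \<open>x \<in> K\<close> show "x \<in> (\<Union>p\<in>K. ball p (d p))" by blast
    qed
  qed auto
  have "0 \<in> DOA f"
  proof -
    have "forward_solution f (\<lambda>t. 0)"
      by (simp add: forward_solution_def f(2))
    from forward_solution_flow[OF f(1) this] show ?thesis
      by (auto simp: DOA_def intro!: tendsto_eventually eventually_mono[OF eventually_ge_at_top[of 0]])
  qed
  define F where "F = insert 0 K'"
  have F: "finite F" "F \<noteq> {}" "F \<subseteq> DOA f" "0 \<in> F"
    using K' K(2) \<open>0 \<in> DOA f\<close> by (auto simp: F_def)
  define J' where "J' = (\<Union>p\<in>F. J p)"
  define d' where "d' = Min (d ` F)"
  define C' where "C' = Max (C ` F)"
  have d': "d' \<le> d p" and C': "C p \<le> C'" and JJ: "J p \<subseteq> J'" if "p \<in> F" for p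
    using that F by (auto simp: d'_def C'_def J'_def)
  show thesis
  proof (rule that)
    show "compact J'" unfolding J'_def using F JdC by (intro compact_UN) auto
    show "K \<subseteq> J'"
    proof
      fix x assume "x \<in> K"
      then obtain p where "p \<in> K'" "x \<in> ball p (d p)" using K'(3) by blast
      then show "x \<in> J'" using JdC[of p] F(3) JJ[of p] unfolding F_def by blast
    qed
    show "0 < d'" unfolding d'_def using F JdC by (subst Min_gr_iff) auto
    show "0 < a / 2" "0 < d 0" using \<open>0 < a\<close> JdC \<open>0 \<in> DOA f\<close> by auto
    show "ball 0 (d 0) \<subseteq> J'" using JdC[OF \<open>0 \<in> DOA f\<close>] JJ[OF F(4)] by blast
  next
    fix g x assume g: "C1_on UNIV g" "g 0 = 0" and x: "x \<in> J'"
      and close: "\<And>x. x \<in> J' \<Longrightarrow> norm (g x - f x) \<le> d' \<and> norm (Df g x - Df f x) \<le> d'"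
    obtain p where p: "p \<in> F" "x \<in> J p" using x by (auto simp: J'_def)
    have "\<forall>x\<in>J p. norm (g x - f x) \<le> d p \<and> norm (Df g x - Df f x) \<le> d p"
      using close JJ[OF p(1)] d'[OF p(1)] by (meson order_trans subsetD)
    then obtain y where y: "y 0 = x" "forward_solution g y" "\<And>t. 0 \<le> t \<Longrightarrow> y t \<in> J p"
        "\<And>t. 0 \<le> t \<Longrightarrow> norm (y t) \<le> C p * exp (- (a / 2) * t)"
      using JdC[of p] F(3) p g unfolding good_def by blast
    note fl = forward_solution_flow[OF g(1) y(2), unfolded y(1)]
    have "norm (flow g t x) \<le> C' * exp (- (a / 2) * t)" if "0 \<le> t" for t
      unfolding fl(2)[OF that]
      by (rule order_trans[OF y(4)[OF that] mult_right_mono[OF C'[OF p(1)] exp_ge_zero]])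
    then show "forward_solution g (\<lambda>t. flow g t x) \<and> flow g 0 x = x \<and>
        (\<forall>t\<ge>0. flow_exists g t x \<and> flow g t x \<in> J' \<and> norm (flow g t x) \<le> C' * exp (- (a / 2) * t))"
      using flow_forward_solution[OF g(1) fl(1)] fl y(3) JJ[OF p(1)] by auto
  qed
qed

lemma norm_le_sup_norm:
  assumes "compact J" "continuous_on J h" "x \<in> J"
  shows "norm (h x) \<le> sup_norm J h"
  unfolding sup_norm_def
proof (rule cSUP_upper[OF \<open>x \<in> J\<close>])
  have "compact ((\<lambda>x. norm (h x)) ` J)"
    using assms by (intro compact_continuous_image continuous_intros)
  then show "bdd_above ((\<lambda>x. norm (h x)) ` J)"
    by (intro bounded_imp_bdd_above compact_imp_bounded)
qed

lemma Df_diff: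
  assumes "C1_on UNIV g" "C1_on UNIV f"
  shows "Df (\<lambda>x. g x - f x) = (\<lambda>x. Df g x - Df f x)"
proof (rule ext, rule blinfun_eqI)
  fix x v
  show "Df (\<lambda>x. g x - f x) x v = (Df g x - Df f x) v"
    using blinfun_apply_Df[OF has_derivative_diff[OF C1_has_derivative[OF assms(1)]
        C1_has_derivative[OF assms(2)]], of x]
    by (simp add: blinfun.diff_left)
qed

lemma C1_on_diff:
  assumes "C1_on UNIV g" "C1_on UNIV f"
  shows "C1_on UNIV (\<lambda>x. g x - f x)"
proof -
  have "(\<lambda>x. g x - f x) differentiable at x" for x
    using assms by (intro differentiable_diff) (auto simp: C1_on_def)
  moreover have "continuous_on UNIV (Df (\<lambda>x. g x - f x))"
    unfolding Df_diff[OF assms] by (intro continuous_on_diff C1_continuous_on_Df assms)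
  ultimately show ?thesis by (simp add: C1_on_def)
qed

lemma C1_norm_bounds:
  assumes "compact J" and h: "C1_on UNIV h" and "x \<in> J"
  shows "0 \<le> C1_norm J h" and "norm (h x) \<le> C1_norm J h" and "norm (Df h x) \<le> C1_norm J h"
  using norm_le_sup_norm[OF assms(1) C1_continuous_on[OF h] assms(3)]
    norm_le_sup_norm[OF assms(1) C1_continuous_on_Df[OF h] assms(3)]
    norm_ge_zero[of "h x"] norm_ge_zero[of "Df h x"]
  unfolding C1_norm_def by linarith+

lemma C1_norm_le_C2_norm:
  assumes "compact J" and h: "C2_on UNIV h" and "x \<in> J"
  shows "C1_norm J h \<le> C2_norm J h"
proof -
  have "C1_on UNIV (Df h)" using h by (simp add: C2_on_def)
  from norm_le_sup_norm[OF assms(1) C1_continuous_on_Df[OF this] assms(3)]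
  show ?thesis using norm_ge_zero[of "Df (Df h) x"] unfolding C1_norm_def C2_norm_def by linarith
qed

text \<open>Near 0 the bound on the derivative is used on a ball, which is convex, while \<open>J\<close> is not; away from 0 the
bound on the values is enough. For \<open>h = \<psi> - \<omega>\<close> this yields a linear bound for \<open>\<psi>\<close> on \<open>J\<close> that is
uniform in \<open>\<psi>\<close>, hence a uniform bound for the tails of the integrals.\<close>

lemma linear_bound_from_C1_bound:
  fixes h :: "'a::euclidean_space \<Rightarrow> real"
  assumes h: "C1_on UNIV h" "h 0 = 0" and "0 < r" "ball 0 r \<subseteq> J"
    and small: "\<And>x. x \<in> J \<Longrightarrow> norm (h x) \<le> 1 \<and> norm (Df h x) \<le> 1" and "x \<in> J"
  shows "\<bar>h x\<bar> \<le> max 1 (1 / r) * norm x"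
proof (cases "x \<in> ball 0 r")
  case True
  have "norm (h x - h 0) \<le> 1 * norm (x - 0)"
  proof (rule differentiable_bound[OF convex_ball])
    fix z :: 'a assume "z \<in> ball 0 r"
    then show "onorm (blinfun_apply (Df h z)) \<le> 1"
      using small assms(4) by (auto simp flip: norm_blinfun.rep_eq)
    show "(h has_derivative blinfun_apply (Df h z)) (at z within ball 0 r)"
      by (rule has_derivative_at_withinI[OF C1_has_derivative[OF h(1)]])
  qed (use True \<open>0 < r\<close> in auto)
  also have "\<dots> \<le> max 1 (1 / r) * norm x"
    using mult_right_mono[of 1 "max 1 (1 / r)" "norm x"] by simp
  finally show ?thesis using h(2) by simp
next
  case False
  then have "1 \<le> 1 / r * norm x" using \<open>0 < r\<close> by (simp add: field_simps)
  also have "\<dots> \<le> max 1 (1 / r) * norm x" by (intro mult_right_mono) auto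
  finally show ?thesis using small[OF \<open>x \<in> J\<close>] by simp
qed

theorem theorem3:
  fixes f :: "real^'n \<Rightarrow> real^'n" and \<omega> :: "real^'n \<Rightarrow> real" and K :: "(real^'n) set"
  assumes "f \<in> Fst" and "\<omega> \<in> Wpos"
    and "compact K" and "K \<subseteq> DOA f"
  shows "\<exists>J. compact J \<and> K \<subseteq> J \<and> J \<subseteq> DOA f \<and>
    (\<forall>\<epsilon>>0. \<exists>\<rho>>0. \<forall>g\<in>Fst. \<forall>\<psi>\<in>Wpos.
      C1_norm J (\<lambda>x. g x - f x) + C2_norm J (\<lambda>x. \<psi> x - \<omega> x) < \<rho> \<longrightarrow>
        (\<forall>x\<in>J. V_defined g \<psi> x) \<and> V g \<psi> \<in> C1_restrictions J \<and>
        sup_norm J (\<lambda>x. V g \<psi> x - V f \<omega> x) < \<epsilon>)"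
proof (rule robust_basin[OF assms(1,3,4)], goal_cases)
  case (1 J d \<gamma> C r)
  note basin = 1(7)
  have f: "C1_on UNIV f" "f 0 = 0" using assms(1) by (auto simp: Fst_def F0_def)
  have om: "C1_on UNIV \<omega>" "\<omega> 0 = 0" "C2_on UNIV \<omega>" using assms(2) by (auto simp: Wpos_def C2_on_def)
  have "0 \<in> J" using 1(5,6) by auto
  have in_DOA: "x \<in> DOA g"
    if "C1_on UNIV g" "g 0 = 0"
      "\<And>x. x \<in> J \<Longrightarrow> norm (g x - f x) \<le> d \<and> norm (Df g x - Df f x) \<le> d" "x \<in> J" for g x
    by (rule exponential_decay_in_DOA[OF _ _ \<open>0 < \<gamma>\<close>, of g x C]) (use basin[OF that] in auto)
  have J_DOA: "J \<subseteq> DOA f"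
    using in_DOA[OF f] \<open>0 < d\<close> by auto
  obtain R where "\<And>x. x \<in> J \<Longrightarrow> norm x \<le> R"
    using compact_imp_bounded[OF \<open>compact J\<close>] unfolding bounded_iff by blast
  then have R: "J \<subseteq> cball 0 R" by auto
  obtain L where "L \<ge> 0"
    and L: "\<And>x y. x \<in> cball 0 R \<Longrightarrow> y \<in> cball 0 R \<Longrightarrow> norm (f x - f y) \<le> L * norm (x - y)"
    using C1_Lipschitz_on_cball[OF f(1)] by metis
  obtain N where "N \<ge> 0"
    and N: "\<And>x y. x \<in> cball 0 R \<Longrightarrow> y \<in> cball 0 R \<Longrightarrow> norm (\<omega> x - \<omega> y) \<le> N * norm (x - y)"
    using C1_Lipschitz_on_cball[OF om(1)] by metis
  define c where "c = 2 * L + 1"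
  have "c > 0" using \<open>L \<ge> 0\<close> by (simp add: c_def)
  have om_lin: "\<bar>\<omega> x\<bar> \<le> N * norm x" if "x \<in> J" for x
    using N[OF subsetD[OF R that] subsetD[OF R \<open>0 \<in> J\<close>]] om(2) by simp
  define P where "P = N + max 1 (1 / r)"
  have "\<exists>\<rho>>0. \<forall>g\<in>Fst. \<forall>\<psi>\<in>Wpos.
      C1_norm J (\<lambda>x. g x - f x) + C2_norm J (\<lambda>x. \<psi> x - \<omega> x) < \<rho> \<longrightarrow>
        (\<forall>x\<in>J. V_defined g \<psi> x) \<and> V g \<psi> \<in> C1_restrictions J \<and>
        sup_norm J (\<lambda>x. V g \<psi> x - V f \<omega> x) < \<epsilon>" if "\<epsilon> > 0" for \<epsilon>
  proof -
    \<comment> \<open>The difference of the integrands will be bounded by \<open>e * exp (- (\<gamma> / 2) * t)\<close> at all times, so that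
      its integral is at most \<open>e / (\<gamma> / 2) = \<epsilon> / 2\<close>. Both integrands are \<open>O(exp (- \<gamma> * t))\<close>, and half of this rate pays for the
      small factor after time \<open>T\<close>; before time \<open>T\<close> the choice of \<open>\<rho>\<close> makes the difference small.\<close>
    define e where "e = \<epsilon> * \<gamma> / 4"
    have "e > 0" using \<open>\<epsilon> > 0\<close> \<open>0 < \<gamma>\<close> by (simp add: e_def)
    have "((\<lambda>t. (P + N) * C * exp (- (\<gamma> / 2) * t)) \<longlongrightarrow> 0) at_top"
      using \<open>0 < \<gamma>\<close> by real_asymp
    then have "eventually (\<lambda>t. 0 \<le> t \<and> (P + N) * C * exp (- (\<gamma> / 2) * t) < e) at_top"
      by (intro eventually_conj eventually_ge_at_top order_tendstoD(2)[OF _ \<open>e > 0\<close>])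
    then obtain T where "0 \<le> T" and T: "(P + N) * C * exp (- (\<gamma> / 2) * T) < e"
      by (auto dest!: eventually_happens)
    define \<rho> where "\<rho> = min (min 1 d) (e * exp (- (\<gamma> / 2) * T) / (1 + N * exp (c * T)))"
    have pos: "1 + N * exp (c * T) > 0" using \<open>N \<ge> 0\<close> by (simp add: add_pos_nonneg)
    have "\<rho> > 0" using \<open>0 < d\<close> \<open>e > 0\<close> pos by (simp add: \<rho>_def)
    have \<rho>: "\<rho> \<le> 1" "\<rho> \<le> d" "\<rho> * (1 + N * exp (c * T)) \<le> e * exp (- (\<gamma> / 2) * T)"
      using pos by (auto simp: \<rho>_def simp flip: pos_le_divide_eq)
    have "(\<forall>x\<in>J. V_defined g \<psi> x) \<and> V g \<psi> \<in> C1_restrictions J \<and>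
        sup_norm J (\<lambda>x. V g \<psi> x - V f \<omega> x) < \<epsilon>"
      if "g \<in> Fst" "\<psi> \<in> Wpos"
        and close: "C1_norm J (\<lambda>x. g x - f x) + C2_norm J (\<lambda>x. \<psi> x - \<omega> x) < \<rho>" for g \<psi>
    proof -
      have g: "C1_on UNIV g" "g 0 = 0" using \<open>g \<in> Fst\<close> by (auto simp: Fst_def F0_def)
      have psi: "C1_on UNIV \<psi>" "\<psi> 0 = 0" "C2_on UNIV \<psi>"
        using \<open>\<psi> \<in> Wpos\<close> by (auto simp: Wpos_def C2_on_def)
      note gf = C1_on_diff[OF g(1) f(1)] and po = C1_on_diff[OF psi(1) om(1)]
      have "C2_on UNIV (\<lambda>x. \<psi> x - \<omega> x)"
        using po psi(3) om(3) C1_on_diff[of "Df \<psi>" "Df \<omega>"]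
        by (simp add: C2_on_def Df_diff[OF psi(1) om(1)])
      note C12 = C1_norm_le_C2_norm[OF \<open>compact J\<close> this \<open>0 \<in> J\<close>]
      have small: "C1_norm J (\<lambda>x. g x - f x) < \<rho>" "C1_norm J (\<lambda>x. \<psi> x - \<omega> x) < \<rho>"
        using close C12 C1_norm_bounds(1)[OF \<open>compact J\<close> gf \<open>0 \<in> J\<close>]
          C1_norm_bounds(1)[OF \<open>compact J\<close> po \<open>0 \<in> J\<close>] by linarith+
      have gf_close: "norm (g x - f x) < \<rho>" "norm (Df g x - Df f x) < \<rho>"
        and po_close: "\<bar>\<psi> x - \<omega> x\<bar> < \<rho>" "norm (Df (\<lambda>x. \<psi> x - \<omega> x) x) < \<rho>" if "x \<in> J" for x
        using C1_norm_bounds(2,3)[OF \<open>compact J\<close> gf that] C1_norm_bounds(2,3)[OF \<open>compact J\<close> po that]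
          small by (auto simp: Df_diff[OF g(1) f(1)])
      have gf_d: "norm (g x - f x) \<le> d \<and> norm (Df g x - Df f x) \<le> d" if "x \<in> J" for x
        using gf_close[OF that] \<rho>(2) by simp
      have ff_d: "norm (f x - f x) \<le> d \<and> norm (Df f x - Df f x) \<le> d" for x
        using \<open>0 < d\<close> by simp
      have J_DOAg: "J \<subseteq> DOA g"
        using in_DOA[OF g gf_d] by blast
      note Vg = Lyapunov_integral_C1[OF \<open>g \<in> Fst\<close> psi(1,2)]
      note Vf = Lyapunov_integral_C1[OF \<open>f \<in> Fst\<close> om(1,2)]
      have psi_lin: "\<bar>\<psi> x\<bar> \<le> P * norm x" if "x \<in> J" for x
      proof -
        have "\<bar>\<psi> x - \<omega> x\<bar> \<le> max 1 (1 / r) * norm x"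
          by (rule linear_bound_from_C1_bound[OF po _ \<open>0 < r\<close> \<open>ball 0 r \<subseteq> J\<close> _ that])
             (use po_close \<rho>(1) psi(2) om(2) in \<open>force+\<close>)
        then show ?thesis using om_lin[OF that] by (simp add: P_def distrib_right)
      qed
      have V_close: "\<bar>V g \<psi> x - V f \<omega> x\<bar> \<le> \<epsilon> / 2" if x: "x \<in> J" for x
      proof -
        define u where "u t = flow g t x" for t
        define v where "v t = flow f t x" for t
        have u: "forward_solution g u" "u 0 = x" "\<And>t. 0 \<le> t \<Longrightarrow> u t \<in> J"
            "\<And>t. 0 \<le> t \<Longrightarrow> norm (u t) \<le> C * exp (- \<gamma> * t)"
          using basin[OF g gf_d x] by (auto simp: u_def[abs_def])
        have v: "forward_solution f v" "v 0 = x" "\<And>t. 0 \<le> t \<Longrightarrow> v t \<in> J"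
            "\<And>t. 0 \<le> t \<Longrightarrow> norm (v t) \<le> C * exp (- \<gamma> * t)"
          using basin[OF f ff_d x] by (auto simp: v_def[abs_def])
        have du: "(u has_vector_derivative g (u t)) (at t within {0..})"
          and dv: "(v has_vector_derivative f (v t)) (at t within {0..})" if "0 \<le> t" for t
          using u(1) v(1) that by (auto simp: forward_solution_def)
        have contu: "continuous_on S u" and contv: "continuous_on S v" if "S \<subseteq> {0..}" for S
          using forward_curve_continuous_on[OF du that] forward_curve_continuous_on[OF dv that] by auto
        have q_bound: "\<bar>\<psi> (u t) - \<omega> (v t)\<bar> \<le> e * exp (- (\<gamma> / 2) * t)" if t: "0 \<le> t" for t
        proof (cases "t \<le> T")
          case True
          have "(norm (u t - v t))\<^sup>2 + \<rho>\<^sup>2 \<le> exp ((2 * L + 1) * (t - 0)) * ((norm (u 0 - v 0))\<^sup>2 + \<rho>\<^sup>2)"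
          proof (rule solutions_stay_close[OF t contu contv])
            fix s assume s: "0 < s" "s < t"
            show "(u has_vector_derivative g (u s)) (at s)" "(v has_vector_derivative f (v s)) (at s)"
              using forward_curve_derivative_at[OF du] forward_curve_derivative_at[OF dv] s by auto
            have us: "u s \<in> J" "v s \<in> J" using u(3) v(3) s by auto
            have "norm (g (u s) - f (v s)) \<le> norm (g (u s) - f (u s)) + norm (f (u s) - f (v s))"
              by (metis diff_add_cancel add_diff_eq norm_triangle_ineq)
            also have "\<dots> \<le> \<rho> + L * norm (u s - v s)"
              using gf_close(1)[OF us(1)] us R by (intro add_mono L) auto
            finally show "norm (g (u s) - f (v s)) \<le> L * norm (u s - v s) + \<rho>" by simp
          qed (use \<open>L \<ge> 0\<close> in auto)
          also have "\<dots> = exp (c * t) * \<rho>\<^sup>2" by (simp add: u(2) v(2) c_def)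
          also have "\<dots> \<le> (exp (c * T))\<^sup>2 * \<rho>\<^sup>2"
          proof (rule mult_right_mono)
            have "c * t \<le> c * T" "0 \<le> c * T" using True t \<open>c > 0\<close> by auto
            then show "exp (c * t) \<le> (exp (c * T))\<^sup>2" by (simp flip: exp_double)
          qed auto
          also have "\<dots> = (exp (c * T) * \<rho>)\<^sup>2" by (simp add: power_mult_distrib)
          finally have "(norm (u t - v t))\<^sup>2 \<le> (exp (c * T) * \<rho>)\<^sup>2"
            using zero_le_power2[of \<rho>] by linarith
          then have uv: "norm (u t - v t) \<le> exp (c * T) * \<rho>"
            using \<open>\<rho> > 0\<close> by (auto dest: power2_le_imp_le)
          have "\<bar>\<omega> (u t) - \<omega> (v t)\<bar> \<le> N * norm (u t - v t)"
            using N[OF subsetD[OF R u(3)[OF t]] subsetD[OF R v(3)[OF t]]] by simp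
          also have "\<dots> \<le> N * (exp (c * T) * \<rho>)"
            using uv \<open>N \<ge> 0\<close> by (rule mult_left_mono)
          finally have "\<bar>\<psi> (u t) - \<omega> (v t)\<bar> \<le> \<rho> * (1 + N * exp (c * T))"
            using po_close(1)[OF u(3)[OF t]] by (simp add: algebra_simps)
          also have "\<dots> \<le> e * exp (- (\<gamma> / 2) * T)" by (rule \<rho>(3))
          also have "\<dots> \<le> e * exp (- (\<gamma> / 2) * t)"
            using True \<open>0 < \<gamma>\<close> \<open>e > 0\<close> by (intro mult_left_mono) auto
          finally show ?thesis .
        next
          case False
          have "P \<ge> 0" using \<open>N \<ge> 0\<close> by (simp add: P_def)
          have "0 \<le> C * exp (- \<gamma> * 0)" using u(4)[of 0] norm_ge_zero order_trans by blast
          then have "C \<ge> 0" by simp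
          have "\<bar>\<psi> (u t) - \<omega> (v t)\<bar> \<le> P * norm (u t) + N * norm (v t)"
            using psi_lin[OF u(3)[OF t]] om_lin[OF v(3)[OF t]] by linarith
          also have "\<dots> \<le> P * (C * exp (- \<gamma> * t)) + N * (C * exp (- \<gamma> * t))"
            using u(4)[OF t] v(4)[OF t] \<open>P \<ge> 0\<close> \<open>N \<ge> 0\<close> by (intro add_mono mult_left_mono) auto
          also have "\<dots> = ((P + N) * C * exp (- (\<gamma> / 2) * t)) * exp (- (\<gamma> / 2) * t)"
            by (simp add: algebra_simps flip: exp_add)
          also have "\<dots> \<le> ((P + N) * C * exp (- (\<gamma> / 2) * T)) * exp (- (\<gamma> / 2) * t)"
            using False \<open>0 < \<gamma>\<close> \<open>P \<ge> 0\<close> \<open>N \<ge> 0\<close> \<open>C \<ge> 0\<close>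
            by (intro mult_right_mono mult_left_mono) auto
          also have "\<dots> \<le> e * exp (- (\<gamma> / 2) * t)"
            using T by (intro mult_right_mono) auto
          finally show ?thesis .
        qed
        have "continuous_on {0..} (\<lambda>t. \<psi> (u t) - \<omega> (v t))"
          by (intro continuous_on_diff continuous_on_compose2[OF C1_continuous_on[OF psi(1), of UNIV] contu]
              continuous_on_compose2[OF C1_continuous_on[OF om(1), of UNIV] contv]) auto
        from exponentially_bounded_integral(2)[OF this q_bound] \<open>0 < \<gamma>\<close>
        have "\<bar>integral {0..} (\<lambda>t. \<psi> (u t) - \<omega> (v t))\<bar> \<le> \<epsilon> / 2"
          by (simp add: e_def)
        moreover have "(\<lambda>t. \<psi> (u t)) integrable_on {0..}" "(\<lambda>t. \<omega> (v t)) integrable_on {0..}"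
          using Vg(3)[of x] Vf(3)[of x] x J_DOAg J_DOA by (auto simp: V_defined_def u_def v_def)
        ultimately show ?thesis
          by (simp add: V_def u_def v_def integral_diff)
      qed
      have "sup_norm J (\<lambda>x. V g \<psi> x - V f \<omega> x) \<le> \<epsilon> / 2"
        unfolding sup_norm_def using \<open>0 \<in> J\<close> V_close by (intro cSUP_least) auto
      moreover have "V g \<psi> \<in> C1_restrictions J"
        unfolding C1_restrictions_def using Vg(1,2) J_DOAg by blast
      ultimately show ?thesis
        using Vg(3) J_DOAg \<open>\<epsilon> > 0\<close> by auto
    qed
    with \<open>\<rho> > 0\<close> show ?thesis by blast
  qed
  then show ?case using 1(1,2) J_DOA by blast
qed

end
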